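(* Let $u\in C^1(\bar\Omega)$ be the solution of $$u_t+a(x,t)u_x+b(x,t)u=f(x,t),\ (x,t)\in\Omega,\qquad u(0,t)=\psi(t),\quad u(x,0)=\phi(x),$$ where $\Omega=(0,L]\times(0,T]$, $a(x,t)\ge\alpha>0$ and $b(x,t)\ge 0$ on $\bar\Omega$, $\psi\in C^2([0,T])$, $\phi\in C^2([0,L])$ and $a,b,f\in C^2(\bar\Omega)$. Let $U$ be the solution of the upwind scheme $$\bigl(D_t^-+a(x_i,t_j)D_x^-+b(x_i,t_j)I\bigr)U(x_i,t_j)=f(x_i,t_j),\quad 1\le i\le N,\ 1\le j\le M,$$ $$U(0,t_j)=u(0,t_j),\ t_j>0,\qquad U(x_i,0)=u(x_i,0),\ x_i\ge 0,$$ on the tensor-product mesh described in the context, and let $\bar U$ be its piecewise bilinear interpolant on $\bar\Omega$. Then there is a constant $C$, independent of $N$ and $M$, such that $$\|\bar U-u\|\le C(N^{-1}+M^{-1}).$$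
   Context: $\|\cdot\|$ is the $L_\infty$ norm on $\bar\Omega=[0,L]\times[0,T]$. The mesh is $\{(x_i,t_j)\}_{0\le i\le N,\,0\le j\le M}$ with $0=x_0<x_1<\dots<x_N=L$, $0=t_0<t_1<\dots<t_M=T$, step sizes $h_i=x_i-x_{i-1}$, $k_j=t_j-t_{j-1}$, satisfying $\max_i h_i\le C_*N^{-1}$ and $\max_j k_j\le C_*M^{-1}$ with a constant $C_*$ independent of $N,M$. The difference operators are $$D_t^-Y(x_i,t_j)=\frac{Y(x_i,t_j)-Y(x_i,t_{j-1})}{k_j},\qquad D_x^-Y(x_i,t_j)=\frac{Y(x_i,t_j)-Y(x_{i-1},t_j)}{h_i},$$ and $I$ is the identity. The data $a,b,f,\phi,\psi$ are fixed (independent of $N,M$); the constant $C$ may depend on them, on $L,T,\alpha$ and on $C_*$. $\bar U$ is the function on $\bar\Omega$ that is bilinear on each mesh cell $[x_{i-1},x_i]\times[t_{j-1},t_j]$ and equals $U$ at all mesh points. *)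

theory Defs
  imports "HOL-Analysis.Analysis" "HOL-Probability.Essential_Supremum"
begin

(* C^k on a closed set S: the derivatives are taken within S, hence one-sided on the boundary.
   Intended for the nondegenerate boxes {0..L} and {0..L} \<times> {0..T}, where the derivative
   within S is unique; for v in Basis, f' p v is the partial derivative of f in direction v. *)
primrec Ck_on :: "nat \<Rightarrow> 'a::euclidean_space set \<Rightarrow> ('a \<Rightarrow> real) \<Rightarrow> bool" where
  "Ck_on 0 S f \<longleftrightarrow> continuous_on S f"
| "Ck_on (Suc k) S f \<longleftrightarrow>
     (\<exists>f'. (\<forall>p\<in>S. (f has_derivative f' p) (at p within S)) \<and>
           (\<forall>v\<in>Basis. Ck_on k S (\<lambda>p. f' p v)))"

definition Linf_norm :: "'a::euclidean_space set \<Rightarrow> ('a \<Rightarrow> real) \<Rightarrow> ereal" where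
  "Linf_norm S g = esssup (lebesgue_on S) (\<lambda>p. ereal \<bar>g p\<bar>)"

(* The equation is imposed on {0<..L} \<times> {0<..T}; at x = L and at t = T the partial
   derivatives are one-sided. *)
definition solves_ibvp ::
  "real \<Rightarrow> real \<Rightarrow> (real \<times> real \<Rightarrow> real) \<Rightarrow> (real \<times> real \<Rightarrow> real) \<Rightarrow> (real \<times> real \<Rightarrow> real) \<Rightarrow>
   (real \<Rightarrow> real) \<Rightarrow> (real \<Rightarrow> real) \<Rightarrow> (real \<times> real \<Rightarrow> real) \<Rightarrow> bool" where
  "solves_ibvp L T a b f \<phi> \<psi> u \<longleftrightarrow>
     (\<forall>x\<in>{0<..L}. \<forall>t\<in>{0<..T}. \<exists>ux ut.
        ((\<lambda>y. u (y, t)) has_real_derivative ux) (at x within {0..L}) \<and>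
        ((\<lambda>s. u (x, s)) has_real_derivative ut) (at t within {0..T}) \<and>
        ut + a (x, t) * ux + b (x, t) * u (x, t) = f (x, t)) \<and>
     (\<forall>t\<in>{0..T}. u (0, t) = \<psi> t) \<and>
     (\<forall>x\<in>{0..L}. u (x, 0) = \<phi> x)"

(* Only the values x 0, ..., x N are relevant. *)
definition mesh :: "real \<Rightarrow> real \<Rightarrow> nat \<Rightarrow> (nat \<Rightarrow> real) \<Rightarrow> bool" where
  "mesh L Cs N x \<longleftrightarrow>
     0 < N \<and> x 0 = 0 \<and> x N = L \<and>
     (\<forall>i\<in>{1..N}. x (i - 1) < x i \<and> x i - x (i - 1) \<le> Cs / real N)"

(* A mesh function Y is given by its index form: Y i j is its value at (x i, t j). *)
definition Dx_minus :: "(nat \<Rightarrow> real) \<Rightarrow> (nat \<Rightarrow> nat \<Rightarrow> real) \<Rightarrow> nat \<Rightarrow> nat \<Rightarrow> real" where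
  "Dx_minus x Y i j = (Y i j - Y (i - 1) j) / (x i - x (i - 1))"

definition Dt_minus :: "(nat \<Rightarrow> real) \<Rightarrow> (nat \<Rightarrow> nat \<Rightarrow> real) \<Rightarrow> nat \<Rightarrow> nat \<Rightarrow> real" where
  "Dt_minus t Y i j = (Y i j - Y i (j - 1)) / (t j - t (j - 1))"

definition solves_upwind ::
  "nat \<Rightarrow> nat \<Rightarrow> (nat \<Rightarrow> real) \<Rightarrow> (nat \<Rightarrow> real) \<Rightarrow>
   (real \<times> real \<Rightarrow> real) \<Rightarrow> (real \<times> real \<Rightarrow> real) \<Rightarrow> (real \<times> real \<Rightarrow> real) \<Rightarrow>
   (real \<times> real \<Rightarrow> real) \<Rightarrow> (nat \<Rightarrow> nat \<Rightarrow> real) \<Rightarrow> bool" where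
  "solves_upwind N M x t a b f u U \<longleftrightarrow>
     (\<forall>i\<in>{1..N}. \<forall>j\<in>{1..M}.
        Dt_minus t U i j + a (x i, t j) * Dx_minus x U i j + b (x i, t j) * U i j
          = f (x i, t j)) \<and>
     (\<forall>j\<in>{1..M}. U 0 j = u (0, t j)) \<and>
     (\<forall>i\<in>{0..N}. U i 0 = u (x i, 0))"

(* Bilinear in the finite element sense (span of 1, x, t, x t), unlike the constant bilinear. *)
definition bilinear_fun_on :: "(real \<times> real) set \<Rightarrow> (real \<times> real \<Rightarrow> real) \<Rightarrow> bool" where
  "bilinear_fun_on S g \<longleftrightarrow>
     (\<exists>c0 c1 c2 c3. \<forall>(x, t)\<in>S. g (x, t) = c0 + c1 * x + c2 * t + c3 * x * t)"

(* This determines V uniquely on the union of the mesh cells, and only there. *)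
definition bilinear_interpolant ::
  "nat \<Rightarrow> nat \<Rightarrow> (nat \<Rightarrow> real) \<Rightarrow> (nat \<Rightarrow> real) \<Rightarrow> (nat \<Rightarrow> nat \<Rightarrow> real) \<Rightarrow>
   (real \<times> real \<Rightarrow> real) \<Rightarrow> bool" where
  "bilinear_interpolant N M x t Y V \<longleftrightarrow>
     (\<forall>i\<in>{1..N}. \<forall>j\<in>{1..M}. bilinear_fun_on ({x (i - 1)..x i} \<times> {t (j - 1)..t j}) V) \<and>
     (\<forall>i\<in>{0..N}. \<forall>j\<in>{0..M}. V (x i, t j) = Y i j)"

end

theory Submission
  imports Defs
begin

text \<open>
The truncation error of the upwind scheme at a node is controlled by the oscillation of
\<open>u\<^sub>x\<close> and \<open>u\<^sub>t\<close> over one mesh cell. It is of first order as soon as the gradient of \<open>u\<close>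
is Lipschitz continuous on the closed rectangle; second derivatives of \<open>u\<close> need not exist (they
may jump across the characteristic through the corner \<open>(0, 0)\<close>). Given such a bound, a
discrete maximum principle (\<open>upwind_stability\<close>) turns the truncation error into a bound on the
nodal errors, and a bilinear function on a cell stays within any bound that holds at the four
corners (\<open>bilinear_max_at_corners\<close>), so between the nodes only the oscillation of \<open>u\<close> over a
cell is added.

The substance is therefore the regularity statement \<open>gradient_Lipschitz\<close>. It does not use
characteristic curves. For small \<open>d > 0\<close> the difference quotient
\<open>q (x, t) = (u (x + d, t) - u (x, t)) / d\<close> is of class C1, tends to \<open>u\<^sub>x\<close> uniformly as \<open>d\<close> tends
to 0, and satisfies a transport equation \<open>q\<^sub>t + a q\<^sub>x = G\<close> (\<open>dq_transport\<close>), in which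
\<open>G\<close> is bounded and \<open>\<bar>G (x, t) - G (y, t)\<bar>\<close> is at most
\<open>C\<^sub>0 \<bar>x - y\<bar> + C\<^sub>1 \<bar>q (x, t) - q (y, t)\<bar>\<close> plus a term that tends to 0 with \<open>d\<close>. Two
barriers follow. First, \<open>q\<close> differs from the inflow value \<open>u\<^sub>x (0, t)\<close> by at most a multiple of
\<open>x\<close>, up to a small error (\<open>inflow_barrier\<close>); here it matters that the equation and the boundary
data determine \<open>u\<^sub>x (0, t)\<close> as a Lipschitz function of \<open>t\<close>, because \<open>a \<ge> \<alpha> > 0\<close>. Second, doubling the
space variable, \<open>q (x, t) - q (y, t)\<close> stays below \<open>K exp (\<nu> t) (x - y + \<epsilon>)\<close> for \<open>y \<le> x\<close>
(\<open>doubled_barrier\<close>): the first barrier handles the boundary \<open>y = 0\<close>, the initial data handle \<open>t = 0\<close>,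
and elsewhere the barrier grows faster along the flow than the difference does when they touch.
Both rest on one maximum principle,
\<open>negative_if_no_first_zero\<close>. Letting \<open>d\<close> and then \<open>\<epsilon>\<close> tend to 0 gives the Lipschitz bound of
\<open>u\<^sub>x\<close> in \<open>x\<close>; the equation transfers it to \<open>u\<^sub>t\<close>, interchanging the order of differencing gives
the bound of \<open>u\<^sub>x\<close> in \<open>t\<close>, and the equation once more that of \<open>u\<^sub>t\<close> in \<open>t\<close>.
\<close>

section \<open>Functions of class C1 and C2 on compact convex sets\<close>

lemma Ck_on_imp_continuous_on: "Ck_on k S g \<Longrightarrow> continuous_on S g"
  by (cases k) (auto intro: has_derivative_continuous simp: continuous_on_eq_continuous_within)

lemma Ck_on_Suc_imp: "Ck_on (Suc k) S g \<Longrightarrow> Ck_on k S g"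
proof (induction k arbitrary: g)
  case 0
  then show ?case using Ck_on_imp_continuous_on by (metis Ck_on.simps(1))
next
  case (Suc k)
  then show ?case by (metis Ck_on.simps(2))
qed

lemma linear_bound_Basis:
  fixes g' :: "'a::euclidean_space \<Rightarrow> real"
  assumes "linear g'" and "\<And>b. b \<in> Basis \<Longrightarrow> \<bar>g' b\<bar> \<le> K"
  shows "\<bar>g' h\<bar> \<le> real DIM('a) * K * norm h"
proof -
  have "g' h = (\<Sum>b\<in>Basis. (h \<bullet> b) * g' b)"
    by (subst euclidean_representation[of h, symmetric])
       (simp add: linear_sum[OF assms(1)] linear_cmul[OF assms(1)])
  also have "\<bar>\<dots>\<bar> \<le> (\<Sum>b\<in>(Basis::'a set). norm h * K)"
    by (rule order_trans[OF sum_abs], rule sum_mono)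
       (use assms(2) in \<open>auto simp: abs_mult Basis_le_norm intro!: mult_mono\<close>)
  finally show ?thesis by (simp add: mult_ac)
qed

lemma derivative_bound_Basis:
  fixes g :: "'a::euclidean_space \<Rightarrow> real"
  assumes "convex S" and "\<And>p. p \<in> S \<Longrightarrow> (g has_derivative g' p) (at p within S)"
    and "\<And>p b. p \<in> S \<Longrightarrow> b \<in> Basis \<Longrightarrow> \<bar>g' p b\<bar> \<le> K"
    and "p \<in> S" "q \<in> S"
  shows "\<bar>g p - g q\<bar> \<le> real DIM('a) * K * norm (p - q)"
proof -
  have "onorm (g' r) \<le> real DIM('a) * K" if "r \<in> S" for r
  proof -
    have "\<bar>g' r h\<bar> \<le> real DIM('a) * K * norm h" for h
      using assms(2,3)[OF that] by (intro linear_bound_Basis) (auto intro: has_derivative_linear)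
    then show ?thesis by (intro onorm_le) simp
  qed
  then show ?thesis
    using differentiable_bound[OF assms(1,2) _ assms(4,5), of "real DIM('a) * K"] by simp
qed

lemma C1_Lipschitz:
  fixes g :: "'a::euclidean_space \<Rightarrow> real"
  assumes S: "compact S" "convex S" and g: "Ck_on 1 S g"
  shows "\<exists>K. \<forall>p\<in>S. \<bar>g p\<bar> \<le> K \<and> (\<forall>q\<in>S. \<bar>g p - g q\<bar> \<le> K * norm (p - q))"
proof -
  obtain g' where g': "\<And>p. p \<in> S \<Longrightarrow> (g has_derivative g' p) (at p within S)"
      "\<And>v. v \<in> Basis \<Longrightarrow> continuous_on S (\<lambda>p. g' p v)"
    using g by auto
  have "\<forall>v\<in>Basis. \<exists>K. \<forall>p\<in>S. \<bar>g' p v\<bar> \<le> K"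
    using compact_imp_bounded[OF compact_continuous_image[OF g'(2) S(1)]]
    unfolding bounded_iff by fastforce
  then obtain K where K: "\<And>v p. v \<in> Basis \<Longrightarrow> p \<in> S \<Longrightarrow> \<bar>g' p v\<bar> \<le> K v"
    by metis
  define K1 where "K1 = (\<Sum>v\<in>(Basis::'a set). \<bar>K v\<bar>)"
  have "\<bar>g' p v\<bar> \<le> K1" if "v \<in> Basis" "p \<in> S" for p v
  proof -
    have "\<bar>K v\<bar> \<le> K1"
      unfolding K1_def by (rule member_le_sum) (use that in auto)
    then show ?thesis using K[OF that] by linarith
  qed
  then have lip: "\<bar>g p - g q\<bar> \<le> real DIM('a) * K1 * norm (p - q)" if "p \<in> S" "q \<in> S" for p q
    using derivative_bound_Basis[OF S(2) g'(1), of K1 p q] that by blast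
  have "continuous_on S g"
    using g by (rule Ck_on_imp_continuous_on)
  then obtain K0 where K0: "\<And>p. p \<in> S \<Longrightarrow> \<bar>g p\<bar> \<le> K0"
    using compact_imp_bounded[OF compact_continuous_image[OF _ S(1), of g]]
    unfolding bounded_iff by fastforce
  have "\<bar>g p - g q\<bar> \<le> max K0 (real DIM('a) * K1) * norm (p - q)" if "p \<in> S" "q \<in> S" for p q
    by (rule order_trans[OF lip[OF that]]) (auto intro: mult_right_mono)
  then show ?thesis
    using K0 by (intro exI[of _ "max K0 (real DIM('a) * K1)"]) (force simp: le_max_iff_disj)
qed

text \<open>The increment \<open>r \<mapsto> g (r + d) - g r\<close> has gradient \<open>g' (r + d) - g' r\<close>, which is at most
a multiple of \<open>norm d\<close> because the partial derivatives of \<open>g\<close> are Lipschitz continuous. Its domain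
\<open>S \<inter> (S - d)\<close> is again convex, so the mean value inequality applies to it.\<close>

lemma C2_second_difference:
  fixes g :: "'a::euclidean_space \<Rightarrow> real"
  assumes S: "compact S" "convex S" and g: "Ck_on 2 S g"
  shows "\<exists>K. \<forall>p q d. p \<in> S \<longrightarrow> q \<in> S \<longrightarrow> p + d \<in> S \<longrightarrow> q + d \<in> S \<longrightarrow>
    \<bar>(g (p + d) - g p) - (g (q + d) - g q)\<bar> \<le> K * norm d * norm (p - q)"
proof -
  obtain g' where g': "\<And>p. p \<in> S \<Longrightarrow> (g has_derivative g' p) (at p within S)"
      "\<And>v. v \<in> Basis \<Longrightarrow> Ck_on 1 S (\<lambda>p. g' p v)"
    using g unfolding numeral_2_eq_2 Ck_on.simps(2)[of "Suc 0"] One_nat_def by blast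
  obtain K where K: "\<And>v p q. v \<in> Basis \<Longrightarrow> p \<in> S \<Longrightarrow> q \<in> S \<Longrightarrow> \<bar>g' p v - g' q v\<bar> \<le> K v * norm (p - q)"
    using C1_Lipschitz[OF S g'(2)] by metis
  define K1 where "K1 = (\<Sum>v\<in>(Basis::'a set). \<bar>K v\<bar>)"
  have K1: "\<bar>g' p v - g' q v\<bar> \<le> K1 * norm (p - q)" if "v \<in> Basis" "p \<in> S" "q \<in> S" for p q v
  proof -
    have "\<bar>K v\<bar> \<le> K1"
      unfolding K1_def by (rule member_le_sum) (use that in auto)
    then have "K v * norm (p - q) \<le> K1 * norm (p - q)"
      by (intro mult_right_mono) auto
    then show ?thesis using K[OF that] by linarith
  qed
  have "\<bar>(g (p + d) - g p) - (g (q + d) - g q)\<bar> \<le> real DIM('a) * K1 * norm d * norm (p - q)"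
    if pq: "p \<in> S" "q \<in> S" "p + d \<in> S" "q + d \<in> S" for p q d
  proof -
    \<comment> \<open>The set of points at which the increment by \<open>d\<close> is defined.\<close>
    define R where "R = S \<inter> (\<lambda>r. r + d) -` S"
    have "(\<lambda>r. r + d) -` S = (\<lambda>r. r - d) ` S"
      by (auto simp: image_def) (metis add_diff_cancel_right')
    then have "convex R"
      unfolding R_def using S(2) convex_translation_subtract[of S d] by (auto intro: convex_Int)
    moreover have "((\<lambda>r. g (r + d) - g r) has_derivative (\<lambda>h. g' (r + d) h - g' r h)) (at r within R)"
      if "r \<in> R" for r
    proof -
      have *: "(g has_derivative g' r) (at r within R)"
        using g'(1)[of r] that by (auto simp: R_def intro: has_derivative_subset)
      have "((\<lambda>r. g (r + d)) has_derivative (\<lambda>h. g' (r + d) h)) (at r within R)"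
        using that
        by (intro has_derivative_in_compose2[where f = "\<lambda>r. r + d" and t = S and f' = "\<lambda>h. h" and g = g and g' = g'])
           (auto simp: R_def intro!: g'(1) derivative_eq_intros)
      then show ?thesis using * by (rule has_derivative_diff)
    qed
    moreover have "\<bar>g' (r + d) b - g' r b\<bar> \<le> K1 * norm d" if "r \<in> R" "b \<in> Basis" for r b
      using K1[of b "r + d" r] that by (auto simp: R_def)
    ultimately have "\<bar>(g (p + d) - g p) - (g (q + d) - g q)\<bar> \<le> real DIM('a) * (K1 * norm d) * norm (p - q)"
      using pq derivative_bound_Basis[of R "\<lambda>r. g (r + d) - g r" "\<lambda>r h. g' (r + d) h - g' r h" "K1 * norm d" p q]
      by (auto simp: R_def)
    then show ?thesis by (simp add: mult_ac)
  qed
  then show ?thesis by blast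
qed

lemma has_partial_derivatives:
  assumes "(g has_derivative D) (at (x, t) within A \<times> B)" "x \<in> A" "t \<in> B"
  shows "((\<lambda>y. g (y, t)) has_real_derivative D (1, 0)) (at x within A)"
    and "((\<lambda>s. g (x, s)) has_real_derivative D (0, 1)) (at t within B)"
proof -
  interpret D: bounded_linear D using assms(1) by (rule has_derivative_bounded_linear)
  have "(g has_derivative D) (at (x, t) within (\<lambda>y. (y, t)) ` A)"
    using assms(3) by (intro has_derivative_subset[OF assms(1)]) auto
  then have "((\<lambda>y. g (y, t)) has_derivative (\<lambda>h. D (h, 0))) (at x within A)"
    by (intro has_derivative_in_compose[where f = "\<lambda>y. (y, t)" and g = g]) (auto intro!: derivative_eq_intros)
  moreover have "(\<lambda>h. D (h, 0)) = (*) (D (1, 0))"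
  proof
    show "D (h, 0) = D (1, 0) * h" for h using D.scaleR[of h "(1, 0)"] by simp
  qed
  ultimately show "((\<lambda>y. g (y, t)) has_real_derivative D (1, 0)) (at x within A)"
    by (simp only: has_field_derivative_def)
  have "(g has_derivative D) (at (x, t) within (\<lambda>s. (x, s)) ` B)"
    using assms(2) by (intro has_derivative_subset[OF assms(1)]) auto
  then have "((\<lambda>s. g (x, s)) has_derivative (\<lambda>h. D (0, h))) (at t within B)"
    by (intro has_derivative_in_compose[where f = "\<lambda>s. (x, s)" and g = g]) (auto intro!: derivative_eq_intros)
  moreover have "(\<lambda>h. D (0, h)) = (*) (D (0, 1))"
  proof
    show "D (0, h) = D (0, 1) * h" for h using D.scaleR[of h "(0, 1)"] by simp
  qed
  ultimately show "((\<lambda>s. g (x, s)) has_real_derivative D (0, 1)) (at t within B)"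
    by (simp only: has_field_derivative_def)
qed

section \<open>A maximum principle and two barriers for the transport equation\<close>

text \<open>A first-touching-time argument. If \<open>w\<close> is negative initially and becomes nonnegative, there is a
least time at which this happens, and there \<open>w\<close> vanishes. A direction pointing into the past
along which \<open>w\<close> increases then leads to a positive value at an earlier time. The hypothesis
asks for such a direction at every zero, and only a one-sided derivative along it, so that it can be
used for \<open>w\<close> on the closed outflow boundary and at the final time.\<close>

lemma negative_if_no_first_zero:
  fixes w :: "'a::euclidean_space \<times> real \<Rightarrow> real"
  assumes Z: "compact Z" and cont: "continuous_on (Z \<times> {0..T}) w"
    and init: "\<And>z. z \<in> Z \<Longrightarrow> w (z, 0) < 0"
    and escape: "\<And>z t. z \<in> Z \<Longrightarrow> 0 < t \<Longrightarrow> t \<le> T \<Longrightarrow> w (z, t) = 0 \<Longrightarrow>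
      \<exists>v d. 0 < d \<and> (\<forall>\<^sub>F s in at_right 0. z - s *\<^sub>R v \<in> Z) \<and>
        ((\<lambda>s. w (z - s *\<^sub>R v, t - s)) has_real_derivative d) (at_right 0)"
    and z: "z \<in> Z" and t: "t \<in> {0..T}"
  shows "w (z, t) < 0"
proof (rule ccontr)
  assume "\<not> w (z, t) < 0"
  define S where "S = (Z \<times> {0..T}) \<inter> w -` {0..}"
  have "compact (Z \<times> {0..T})"
    using Z by (intro compact_Times) auto
  moreover have "closedin (top_of_set (Z \<times> {0..T})) S"
    unfolding S_def using cont by (intro continuous_closedin_preimage) auto
  ultimately have "compact S"
    by (metis closedin_compact)
  moreover have "(z, t) \<in> S"
    using \<open>\<not> w (z, t) < 0\<close> z t by (auto simp: S_def)
  ultimately obtain p where p: "p \<in> S" "\<And>p'. p' \<in> S \<Longrightarrow> snd p \<le> snd p'"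
    using continuous_attains_inf[of S snd] by (force intro: continuous_on_snd continuous_on_id)
  obtain y \<tau> where y: "p = (y, \<tau>)" by force
  have y_in: "y \<in> Z" "\<tau> \<in> {0..T}" "w (y, \<tau>) \<ge> 0"
    using p(1) by (auto simp: S_def y)
  have first: "\<tau> \<le> s" if "y' \<in> Z" "s \<in> {0..T}" "w (y', s) \<ge> 0" for y' s
    using p(2)[of "(y', s)"] that by (auto simp: S_def y)
  have pos: "0 < \<tau>"
    using y_in init[of y] by (cases "\<tau> = 0") auto
  have "continuous_on {0..\<tau>} (\<lambda>s. w (y, s))"
    using y_in by (intro continuous_on_compose2[OF cont]) (auto intro!: continuous_intros)
  then obtain s where "0 \<le> s" "s \<le> \<tau>" "w (y, s) = 0"
    using IVT'[of "\<lambda>s. w (y, s)" 0 0 \<tau>] init[of y] y_in by force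
  then have zero: "w (y, \<tau>) = 0"
    using first[of y s] y_in by auto
  obtain v d where vd: "0 < d" "\<forall>\<^sub>F s in at_right 0. y - s *\<^sub>R v \<in> Z"
      "((\<lambda>s. w (y - s *\<^sub>R v, \<tau> - s)) has_real_derivative d) (at_right 0)"
    using escape[of y \<tau>] y_in pos zero by auto
  obtain e where e: "0 < e" "\<And>s. 0 < s \<Longrightarrow> s < e \<Longrightarrow> 0 < w (y - s *\<^sub>R v, \<tau> - s)"
    using has_real_derivative_pos_inc_right[OF vd(3,1)] zero by auto
  obtain e' where e': "0 < e'" "\<And>s. 0 < s \<Longrightarrow> s < e' \<Longrightarrow> y - s *\<^sub>R v \<in> Z"
    using vd(2) by (auto simp: eventually_at_right_field)
  define s where "s = min (min e e') \<tau> / 2"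
  have "0 < s" "s < e" "s < e'" "s < \<tau>"
    using e(1) e'(1) pos by (auto simp: s_def)
  then show False
    using first[of "y - s *\<^sub>R v" "\<tau> - s"] e(2)[of s] e'(2)[of s] y_in by auto
qed

text \<open>The barrier \<open>c + \<mu> (t\<^sub>0 - t) + \<kappa> x\<close> grows along the flow at a rate of at least
\<open>\<kappa> \<alpha> - \<mu>\<close>, which exceeds the growth rate \<open>\<Gamma>\<close> of \<open>q\<close>. The term \<open>\<mu> (t\<^sub>0 - t)\<close> absorbs
the variation in time of the inflow values of \<open>q\<close>, which therefore need only be Lipschitz, and
it vanishes at the time of interest \<open>t = t\<^sub>0\<close>.\<close>

lemma inflow_barrier:
  fixes q a G :: "real \<times> real \<Rightarrow> real"
  assumes cont: "continuous_on ({0..X} \<times> {0..t\<^sub>0}) q"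
    and transport: "\<And>x t. 0 < x \<Longrightarrow> x \<le> X \<Longrightarrow> 0 < t \<Longrightarrow> t \<le> t\<^sub>0 \<Longrightarrow>
      ((\<lambda>s. q (x - s * a (x, t), t - s)) has_real_derivative - G (x, t)) (at_right 0)"
    and G: "\<And>x t. 0 < x \<Longrightarrow> x \<le> X \<Longrightarrow> 0 < t \<Longrightarrow> t \<le> t\<^sub>0 \<Longrightarrow> G (x, t) \<le> \<Gamma>"
    and a: "\<And>x t. 0 < x \<Longrightarrow> x \<le> X \<Longrightarrow> 0 < t \<Longrightarrow> t \<le> t\<^sub>0 \<Longrightarrow> \<alpha> \<le> a (x, t)"
    and slope: "0 < \<alpha>" "0 \<le> \<kappa>" "\<Gamma> + \<mu> < \<kappa> * \<alpha>"
    and inflow: "\<And>t. t \<in> {0..t\<^sub>0} \<Longrightarrow> q (0, t) < c + \<mu> * (t\<^sub>0 - t)"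
    and init: "\<And>x. x \<in> {0..X} \<Longrightarrow> q (x, 0) < c + \<mu> * t\<^sub>0 + \<kappa> * x"
    and x: "x \<in> {0..X}" and t: "t \<in> {0..t\<^sub>0}"
  shows "q (x, t) < c + \<mu> * (t\<^sub>0 - t) + \<kappa> * x"
proof -
  define w where "w = (\<lambda>p. q p - (c + \<mu> * (t\<^sub>0 - snd p) + \<kappa> * fst p))"
  have "w (x, t) < 0"
  proof (rule negative_if_no_first_zero[where Z = "{0..X}" and T = t\<^sub>0])
    show "continuous_on ({0..X} \<times> {0..t\<^sub>0}) w"
      unfolding w_def by (intro continuous_intros cont)
    show "w (z, 0) < 0" if "z \<in> {0..X}" for z
      using init[OF that] by (simp add: w_def)
    fix z \<tau> assume *: "z \<in> {0..X}" "0 < \<tau>" "\<tau> \<le> t\<^sub>0" "w (z, \<tau>) = 0"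
    have "z \<noteq> 0"
      using inflow[of \<tau>] * by (auto simp: w_def)
    then have z: "0 < z" "z \<le> X" using * by auto
    let ?A = "a (z, \<tau>)"
    have A: "\<alpha> \<le> ?A" "G (z, \<tau>) \<le> \<Gamma>"
      using a[of z \<tau>] G[of z \<tau>] z * by auto
    \<comment> \<open>Going back along the flow the barrier falls faster than \<open>q\<close> can.\<close>
    have "((\<lambda>s. w (z - s *\<^sub>R ?A, \<tau> - s)) has_real_derivative - G (z, \<tau>) - (\<mu> - \<kappa> * ?A)) (at_right 0)"
      unfolding w_def using transport[of z \<tau>] z *
      by (auto intro!: derivative_eq_intros simp: algebra_simps)
    moreover have "\<kappa> * \<alpha> \<le> \<kappa> * ?A"
      using A slope by (intro mult_left_mono) auto
    then have "- G (z, \<tau>) - (\<mu> - \<kappa> * ?A) > 0"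
      using A slope by auto
    moreover have "\<forall>\<^sub>F s in at_right 0. z - s *\<^sub>R ?A \<in> {0..X}"
    proof -
      have "s * ?A \<le> z \<and> 0 \<le> s * ?A" if "0 < s" "s < z / ?A" for s
        using that A slope by (auto simp: field_simps)
      then show ?thesis
        unfolding eventually_at_right_field using z A slope
        by (intro exI[of _ "z / ?A"] conjI allI impI) (simp, smt (verit) atLeastAtMost_iff real_scaleR_def)
    qed
    ultimately show "\<exists>v d. 0 < d \<and> (\<forall>\<^sub>F s in at_right 0. z - s *\<^sub>R v \<in> {0..X}) \<and>
        ((\<lambda>s. w (z - s *\<^sub>R v, \<tau> - s)) has_real_derivative d) (at_right 0)"
      by blast
  qed (use x t in auto)
  then show ?thesis by (simp add: w_def)
qed

text \<open>Doubling of the space variable: \<open>q (x, t) - q (y, t)\<close> is followed along the flow of the pair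
\<open>(x, y)\<close>. If it touches the barrier \<open>E (x - y + \<epsilon>)\<close>, \<open>E = K exp ((A + C + 1) t)\<close>, then the
difference of the sources contributes at most \<open>C\<close> times the barrier, the spreading of the two
velocities at most \<open>A\<close> times the barrier, and the remaining \<open>1\<close> in the exponent dominates
\<open>K (x - y) + \<eta>\<close>. The shift \<open>\<epsilon>\<close> keeps the barrier away from zero on the diagonal \<open>x = y\<close>
and pays for the perturbation \<open>\<eta>\<close> of the source.\<close>

lemma doubled_barrier:
  fixes q a G :: "real \<times> real \<Rightarrow> real"
  assumes cont: "continuous_on ({0..X} \<times> {0..T}) q"
    and transport: "\<And>x t. 0 < x \<Longrightarrow> x \<le> X \<Longrightarrow> 0 < t \<Longrightarrow> t \<le> T \<Longrightarrow>
      ((\<lambda>s. q (x - s * a (x, t), t - s)) has_real_derivative - G (x, t)) (at_right 0)"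
    and G: "\<And>x y t. 0 < y \<Longrightarrow> y < x \<Longrightarrow> x \<le> X \<Longrightarrow> 0 < t \<Longrightarrow> t \<le> T \<Longrightarrow>
      G (x, t) - G (y, t) \<le> K * (x - y) + C * \<bar>q (x, t) - q (y, t)\<bar> + \<eta>"
    and a_pos: "\<And>x t. 0 < x \<Longrightarrow> x \<le> X \<Longrightarrow> 0 < t \<Longrightarrow> t \<le> T \<Longrightarrow> 0 < a (x, t)"
    and a_lip: "\<And>x y t. 0 < y \<Longrightarrow> y < x \<Longrightarrow> x \<le> X \<Longrightarrow> 0 < t \<Longrightarrow> t \<le> T \<Longrightarrow>
      \<bar>a (x, t) - a (y, t)\<bar> \<le> A * (x - y)"
    and const: "0 \<le> A" "0 \<le> C" "0 \<le> K" "0 < \<epsilon>" "\<eta> < K * \<epsilon>"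
    and inflow: "\<And>x t. x \<in> {0..X} \<Longrightarrow> t \<in> {0..T} \<Longrightarrow> q (x, t) - q (0, t) < K * (x + \<epsilon>)"
    and init: "\<And>x y. 0 \<le> y \<Longrightarrow> y \<le> x \<Longrightarrow> x \<le> X \<Longrightarrow> q (x, 0) - q (y, 0) < K * (x - y + \<epsilon>)"
    and xy: "0 \<le> y" "y \<le> x" "x \<le> X" and t: "t \<in> {0..T}"
  shows "q (x, t) - q (y, t) < K * exp ((A + C + 1) * t) * (x - y + \<epsilon>)"
proof -
  have "0 < K * \<epsilon>"
    using init[of x x] xy by (simp add: mult_pos_pos)
  then have "0 < K" using const by (simp add: zero_less_mult_iff)
  define \<nu> where "\<nu> = A + C + 1"
  define E where "E = (\<lambda>t. K * exp (\<nu> * t))"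
  define Z where "Z = {z :: real \<times> real. 0 \<le> snd z \<and> snd z \<le> fst z \<and> fst z \<le> X}"
  define w where "w = (\<lambda>p. q (fst (fst p), snd p) - q (snd (fst p), snd p)
    - E (snd p) * (fst (fst p) - snd (fst p) + \<epsilon>))"
  have E_ge: "K \<le> E s" if "0 \<le> s" for s
    using that const \<open>0 < K\<close> by (simp add: E_def \<nu>_def)
  have "w ((x, y), t) < 0"
  proof (rule negative_if_no_first_zero[where Z = Z and T = T])
    have "Z = ({0..X} \<times> {0..X}) \<inter> {z. snd z \<le> fst z}"
      by (auto simp: Z_def)
    moreover have "closed {z :: real \<times> real. snd z \<le> fst z}"
      by (intro closed_Collect_le continuous_intros)
    ultimately show "compact Z"
      by (auto intro!: compact_Int_closed compact_Times)
    show "continuous_on (Z \<times> {0..T}) w"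
      unfolding w_def E_def
      by (intro continuous_intros continuous_on_compose2[OF cont]) (auto simp: Z_def)
    show "w (z, 0) < 0" if "z \<in> Z" for z
      using init[of "snd z" "fst z"] that by (simp add: w_def E_def Z_def)
    show "(x, y) \<in> Z" using xy by (simp add: Z_def)
    fix z \<tau> assume *: "z \<in> Z" "0 < \<tau>" "\<tau> \<le> T" "w (z, \<tau>) = 0"
    obtain x y where z: "z = (x, y)" by force
    have dom: "0 \<le> y" "y \<le> x" "x \<le> X" using * by (auto simp: z Z_def)
    let ?B = "E \<tau> * (x - y + \<epsilon>)"
    have touch: "q (x, \<tau>) - q (y, \<tau>) = ?B"
      using * by (simp add: w_def z)
    have B_ge: "K * (x - y + \<epsilon>) \<le> ?B"
      using E_ge[of \<tau>] dom const * by (intro mult_right_mono) auto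
    have "y \<noteq> 0" using inflow[of x \<tau>] touch B_ge dom * by auto
    moreover have "x \<noteq> y"
      using touch B_ge \<open>0 < K * \<epsilon>\<close> by auto
    ultimately have dom': "0 < y" "y < x" "0 < x" "y \<le> X" using dom by auto
    let ?a = "a (x, \<tau>)" and ?a' = "a (y, \<tau>)"
    have ap: "0 < ?a" "0 < ?a'" "\<bar>?a - ?a'\<bar> \<le> A * (x - y)"
      using a_pos[of x \<tau>] a_pos[of y \<tau>] a_lip[of y x \<tau>] dom dom' * by auto
    let ?d = "- G (x, \<tau>) + G (y, \<tau>) + \<nu> * ?B + E \<tau> * (?a - ?a')"
    have "((\<lambda>s. w (z - s *\<^sub>R (?a, ?a'), \<tau> - s)) has_real_derivative ?d) (at_right 0)"
      unfolding w_def E_def z using transport[of x \<tau>] transport[of y \<tau>] dom dom' *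
      by (auto intro!: derivative_eq_intros simp: algebra_simps)
    moreover have "?d > 0"
    proof -
      have "0 \<le> E \<tau>" using E_ge[of \<tau>] \<open>0 < K\<close> * by auto
      moreover have "A * (x - y) \<le> A * (x - y + \<epsilon>)"
        using const by (intro mult_left_mono) auto
      then have "- (?a - ?a') \<le> A * (x - y + \<epsilon>)"
        using ap by linarith
      ultimately have "E \<tau> * - (?a - ?a') \<le> E \<tau> * (A * (x - y + \<epsilon>))"
        by (intro mult_left_mono)
      then have 1: "- (E \<tau> * (?a - ?a')) \<le> A * ?B" by (simp add: algebra_simps)
      have "0 \<le> ?B" using \<open>0 \<le> E \<tau>\<close> dom const by simp
      then have 2: "G (x, \<tau>) - G (y, \<tau>) \<le> K * (x - y) + C * ?B + \<eta>"
        using G[of y x \<tau>] dom dom' * touch by auto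
      have 3: "K * (x - y) + \<eta> < ?B"
        using B_ge const by (simp add: algebra_simps)
      have "\<nu> * ?B = A * ?B + C * ?B + ?B"
        by (simp add: \<nu>_def algebra_simps)
      then show ?thesis using 1 2 3 by linarith
    qed
    moreover have "\<forall>\<^sub>F s in at_right 0. z - s *\<^sub>R (?a, ?a') \<in> Z"
    proof -
      have "((\<lambda>s. y - s * ?a') \<longlongrightarrow> y - 0 * ?a') (at_right 0)"
        "((\<lambda>s. (x - s * ?a) - (y - s * ?a')) \<longlongrightarrow> (x - 0 * ?a) - (y - 0 * ?a')) (at_right 0)"
        by (intro tendsto_intros)+
      from this[THEN order_tendstoD(1), of 0]
      have "\<forall>\<^sub>F s in at_right 0. 0 < y - s * ?a'"
        "\<forall>\<^sub>F s in at_right 0. 0 < (x - s * ?a) - (y - s * ?a')"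
        using dom' by simp_all
      moreover have "\<forall>\<^sub>F s in at_right (0::real). 0 < s"
        by (simp add: eventually_at_right_less)
      ultimately show ?thesis
      proof eventually_elim
        case (elim s)
        then have "0 < s * ?a" using ap by simp
        then show ?case using elim dom by (auto simp: Z_def z)
      qed
    qed
    ultimately show "\<exists>v d. 0 < d \<and> (\<forall>\<^sub>F s in at_right 0. z - s *\<^sub>R v \<in> Z) \<and>
        ((\<lambda>s. w (z - s *\<^sub>R v, \<tau> - s)) has_real_derivative d) (at_right 0)"
      by blast
  qed (use t in auto)
  then show ?thesis by (simp add: w_def E_def \<nu>_def)
qed

section \<open>Difference quotients of the solution\<close>

lemma abs_mult_diff_le:
  fixes p q p' q' :: real
  assumes "\<bar>p - p'\<bar> \<le> d" "\<bar>q\<bar> \<le> m" "\<bar>p'\<bar> \<le> m'" "\<bar>q - q'\<bar> \<le> e"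
  shows "\<bar>p * q - p' * q'\<bar> \<le> d * m + m' * e"
proof -
  have "p * q - p' * q' = (p - p') * q + p' * (q - q')"
    by (simp add: algebra_simps)
  also have "\<bar>\<dots>\<bar> \<le> \<bar>p - p'\<bar> * \<bar>q\<bar> + \<bar>p'\<bar> * \<bar>q - q'\<bar>"
    by (metis abs_mult abs_triangle_ineq)
  also have "\<dots> \<le> d * m + m' * e"
    using assms by (intro add_mono mult_mono) auto
  finally show ?thesis .
qed

text \<open>The consequences of smooth data that the regularity argument needs, with one constant \<open>K\<close> for all of
them. Second differences stand in for bounds on second derivatives; for \<open>u\<close> itself they are
available only on the initial line, where \<open>u\<close> is the given datum, and likewise \<open>u\<^sub>t\<close> is known
to be Lipschitz only on the inflow boundary.\<close>

locale bounded_advection =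
  fixes L T \<alpha> K :: real and a b f u u\<^sub>x u\<^sub>t :: "real \<times> real \<Rightarrow> real"
  assumes pos: "0 < L" "0 < T" "0 < \<alpha>"
    and u_derivative: "\<And>p. p \<in> {0..L} \<times> {0..T} \<Longrightarrow>
      (u has_derivative (\<lambda>v. fst v * u\<^sub>x p + snd v * u\<^sub>t p)) (at p within {0..L} \<times> {0..T})"
    and u\<^sub>x_continuous: "continuous_on ({0..L} \<times> {0..T}) u\<^sub>x"
    and pde: "\<And>p. p \<in> {0..L} \<times> {0..T} \<Longrightarrow> u\<^sub>t p + a p * u\<^sub>x p + b p * u p = f p"
    and a_ge: "\<And>p. p \<in> {0..L} \<times> {0..T} \<Longrightarrow> \<alpha> \<le> a p"
    and bound: "\<And>g p. g \<in> {a, b, f, u, u\<^sub>x} \<Longrightarrow> p \<in> {0..L} \<times> {0..T} \<Longrightarrow> \<bar>g p\<bar> \<le> K"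
    and Lipschitz: "\<And>g x y t s. g \<in> {a, b, f, u} \<Longrightarrow>
      x \<in> {0..L} \<Longrightarrow> y \<in> {0..L} \<Longrightarrow> t \<in> {0..T} \<Longrightarrow> s \<in> {0..T} \<Longrightarrow>
      \<bar>g (x, t) - g (y, s)\<bar> \<le> K * (\<bar>x - y\<bar> + \<bar>t - s\<bar>)"
    and second_difference: "\<And>g x y d t. g \<in> {a, b, f} \<or> g = u \<and> t = 0 \<Longrightarrow> 0 < d \<Longrightarrow>
      x \<in> {0..L - d} \<Longrightarrow> y \<in> {0..L - d} \<Longrightarrow> t \<in> {0..T} \<Longrightarrow>
      \<bar>(g (x + d, t) - g (x, t)) - (g (y + d, t) - g (y, t))\<bar> \<le> K * d * \<bar>x - y\<bar>"
    and inflow_Lipschitz: "\<And>t s. t \<in> {0..T} \<Longrightarrow> s \<in> {0..T} \<Longrightarrow>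
      \<bar>u\<^sub>t (0, t) - u\<^sub>t (0, s)\<bar> \<le> K * \<bar>t - s\<bar>"
begin

lemma K_nonneg: "0 \<le> K"
  using bound[of a "(0, 0)"] pos by auto

lemma u_partial_derivatives:
  assumes "x \<in> {0..L}" "t \<in> {0..T}"
  shows "((\<lambda>y. u (y, t)) has_real_derivative u\<^sub>x (x, t)) (at x within {0..L})"
    and "((\<lambda>s. u (x, s)) has_real_derivative u\<^sub>t (x, t)) (at t within {0..T})"
  using has_partial_derivatives[OF u_derivative[of "(x, t)"]] assms by auto

lemma u_derivative_backward:
  assumes "0 < x" "x \<le> L" "0 < t" "t \<le> T" "0 \<le> v"
  shows "((\<lambda>s. u (x - s * v, t - s)) has_real_derivative - (v * u\<^sub>x (x, t) + u\<^sub>t (x, t))) (at_right 0)"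
proof -
  \<comment> \<open>The segment traced backward from \<open>(x, t)\<close> stays in the rectangle up to this parameter;
    the summand 1 avoids a division by zero when \<open>v = 0\<close>.\<close>
  define e where "e = min t (x / (v + 1))"
  have "e \<le> x / (v + 1)" by (simp add: e_def)
  then have "e * (v + 1) \<le> x"
    using assms by (simp add: pos_le_divide_eq)
  then have e: "0 < e" "e \<le> t" "e * (v + 1) \<le> x"
    using assms by (auto simp: e_def)
  have in_box: "(x - s * v, t - s) \<in> {0..L} \<times> {0..T}" if "s \<in> {0..e}" for s
  proof -
    have "s * v \<le> e * (v + 1)"
      using that assms e by (intro mult_mono) auto
    moreover have "0 \<le> s * v" using that assms by simp
    ultimately have "0 \<le> x - s * v" "x - s * v \<le> L"
      using e assms by linarith+
    then show ?thesis using that e assms by auto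
  qed
  have "((\<lambda>s. u (x - s * v, t - s)) has_derivative
      (\<lambda>h. fst (- h * v, - h) * u\<^sub>x (x - 0 * v, t - 0) + snd (- h * v, - h) * u\<^sub>t (x - 0 * v, t - 0))) (at 0 within {0..e})"
    using in_box e by (intro has_derivative_in_compose2[OF u_derivative])
      (auto intro!: derivative_eq_intros)
  then have "((\<lambda>s. u (x - s * v, t - s)) has_real_derivative - (v * u\<^sub>x (x, t) + u\<^sub>t (x, t))) (at 0 within {0..e})"
    unfolding has_field_derivative_def by (rule has_derivative_eq_rhs) (auto simp: algebra_simps)
  then show ?thesis
    using e by (simp add: at_within_Icc_at_right)
qed

lemma u_mean_value_x:
  assumes "0 \<le> y" "y < x" "x \<le> L" "t \<in> {0..T}"
  shows "\<exists>\<xi>\<in>{y<..<x}. u (x, t) - u (y, t) = (x - y) * u\<^sub>x (\<xi>, t)"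
proof -
  have "\<exists>\<xi>\<in>{y<..<x}. u (x, t) - u (y, t) = u\<^sub>x (\<xi>, t) * (x - y)"
  proof (rule mvt_simple[OF assms(2)])
    fix z assume "y \<le> z" "z \<le> x"
    then have "((\<lambda>y. u (y, t)) has_real_derivative u\<^sub>x (z, t)) (at z within {y..x})"
      using assms by (intro DERIV_subset[OF u_partial_derivatives(1)]) auto
    then show "((\<lambda>y. u (y, t)) has_derivative (*) (u\<^sub>x (z, t))) (at z within {y..x})"
      by (simp add: has_field_derivative_def)
  qed
  then show ?thesis by (simp add: mult.commute)
qed

lemma u_mean_value_t:
  assumes "0 \<le> s" "s < t" "t \<le> T" "x \<in> {0..L}"
  shows "\<exists>\<tau>\<in>{s<..<t}. u (x, t) - u (x, s) = (t - s) * u\<^sub>t (x, \<tau>)"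
proof -
  have "\<exists>\<tau>\<in>{s<..<t}. u (x, t) - u (x, s) = u\<^sub>t (x, \<tau>) * (t - s)"
  proof (rule mvt_simple[OF assms(2)])
    fix z assume "s \<le> z" "z \<le> t"
    then have "((\<lambda>s. u (x, s)) has_real_derivative u\<^sub>t (x, z)) (at z within {s..t})"
      using assms by (intro DERIV_subset[OF u_partial_derivatives(2)]) auto
    then show "((\<lambda>s. u (x, s)) has_derivative (*) (u\<^sub>t (x, z))) (at z within {s..t})"
      by (simp add: has_field_derivative_def)
  qed
  then show ?thesis by (simp add: mult.commute)
qed

definition dq :: "real \<Rightarrow> (real \<times> real \<Rightarrow> real) \<Rightarrow> real \<times> real \<Rightarrow> real"
  where "dq d g p = (g (fst p + d, snd p) - g p) / d"

text \<open>What remains of the differenced equation once \<open>dq d u\<close> is transported with the velocity \<open>a\<close> at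
the unshifted point: by the discrete product rule the increment of \<open>a\<close> then multiplies
\<open>u\<^sub>x\<close> at the shifted point.\<close>

definition dq_source :: "real \<Rightarrow> real \<times> real \<Rightarrow> real"
  where "dq_source d p = dq d f p - dq d b p * u (fst p + d, snd p) - b p * dq d u p
    - dq d a p * u\<^sub>x (fst p + d, snd p)"

lemma dq_bound:
  assumes "g \<in> {a, b, f, u}" "0 < d" "x \<in> {0..L - d}" "t \<in> {0..T}"
  shows "\<bar>dq d g (x, t)\<bar> \<le> K"
  using Lipschitz[of g "x + d" x t t] assms by (auto simp: dq_def field_simps)

lemma dq_Lipschitz:
  assumes "g \<in> {a, b, f} \<or> g = u \<and> t = 0" "0 < d" "x \<in> {0..L - d}" "y \<in> {0..L - d}" "t \<in> {0..T}"
  shows "\<bar>dq d g (x, t) - dq d g (y, t)\<bar> \<le> K * \<bar>x - y\<bar>"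
proof -
  have "dq d g (x, t) - dq d g (y, t) = ((g (x + d, t) - g (x, t)) - (g (y + d, t) - g (y, t))) / d"
    by (simp add: dq_def diff_divide_distrib)
  moreover have "\<bar>(g (x + d, t) - g (x, t)) - (g (y + d, t) - g (y, t))\<bar> \<le> K * d * \<bar>x - y\<bar>"
    using assms by (intro second_difference)
  ultimately show ?thesis
    using assms(2) by (simp add: abs_divide divide_le_eq mult_ac)
qed

lemma dq_approximates:
  assumes "0 < \<eta>"
  shows "\<exists>d\<^sub>0>0. \<forall>d x t. 0 < d \<longrightarrow> d < d\<^sub>0 \<longrightarrow> x \<in> {0..L - d} \<longrightarrow> t \<in> {0..T} \<longrightarrow>
    \<bar>dq d u (x, t) - u\<^sub>x (x, t)\<bar> < \<eta> \<and> \<bar>dq d u (x, t) - u\<^sub>x (x + d, t)\<bar> < \<eta>"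
proof -
  have "uniformly_continuous_on ({0..L} \<times> {0..T}) u\<^sub>x"
    by (intro compact_uniformly_continuous u\<^sub>x_continuous compact_Times) auto
  then obtain d\<^sub>0 where d\<^sub>0: "0 < d\<^sub>0"
      "\<And>p q. p \<in> {0..L} \<times> {0..T} \<Longrightarrow> q \<in> {0..L} \<times> {0..T} \<Longrightarrow> dist q p < d\<^sub>0 \<Longrightarrow> dist (u\<^sub>x q) (u\<^sub>x p) < \<eta>"
    using assms unfolding uniformly_continuous_on_def by blast
  show ?thesis
  proof (intro exI[of _ d\<^sub>0] conjI[OF d\<^sub>0(1)] allI impI)
    fix d x t assume *: "0 < d" "d < d\<^sub>0" "x \<in> {0..L - d}" "t \<in> {0..T}"
    obtain \<xi> where \<xi>: "\<xi> \<in> {x<..<x + d}" "u (x + d, t) - u (x, t) = d * u\<^sub>x (\<xi>, t)"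
      using u_mean_value_x[of x "x + d" t] * by auto
    then have "dq d u (x, t) = u\<^sub>x (\<xi>, t)" using * by (simp add: dq_def)
    moreover have "dist (u\<^sub>x (\<xi>, t)) (u\<^sub>x (z, t)) < \<eta>" if "z \<in> {x, x + d}" for z
      using d\<^sub>0(2)[of "(z, t)" "(\<xi>, t)"] that \<xi> * by (auto simp: dist_Pair_Pair dist_real_def)
    ultimately show "\<bar>dq d u (x, t) - u\<^sub>x (x, t)\<bar> < \<eta> \<and> \<bar>dq d u (x, t) - u\<^sub>x (x + d, t)\<bar> < \<eta>"
      by (simp add: dist_real_def)
  qed
qed

lemma dq_continuous:
  assumes "0 < d"
  shows "continuous_on ({0..L - d} \<times> {0..T}) (dq d u)"
proof -
  have "continuous_on ({0..L} \<times> {0..T}) u"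
    using u_derivative by (meson continuous_on_eq_continuous_within has_derivative_continuous)
  then have "continuous_on ({0..L - d} \<times> {0..T}) (\<lambda>p. u (fst p + d, snd p))"
    "continuous_on ({0..L - d} \<times> {0..T}) u"
    using assms
    by (auto intro!: continuous_intros elim!: continuous_on_compose2 continuous_on_subset)
  then show ?thesis
    unfolding dq_def using assms by (intro continuous_intros) auto
qed

lemma dq_transport:
  assumes "0 < d" "0 < x" "x \<le> L - d" "0 < t" "t \<le> T"
  shows "((\<lambda>s. dq d u (x - s * a (x, t), t - s)) has_real_derivative - dq_source d (x, t)) (at_right 0)"
proof -
  let ?v = "a (x, t)"
  have v: "0 \<le> ?v" using a_ge[of "(x, t)"] assms pos by auto
  have "((\<lambda>s. (u (x + d - s * ?v, t - s) - u (x - s * ?v, t - s)) / d) has_real_derivative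
      (- (?v * u\<^sub>x (x + d, t) + u\<^sub>t (x + d, t)) - - (?v * u\<^sub>x (x, t) + u\<^sub>t (x, t))) / d) (at_right 0)"
    using assms v by (intro DERIV_cdivide DERIV_diff u_derivative_backward) auto
  moreover have "(- (?v * u\<^sub>x (x + d, t) + u\<^sub>t (x + d, t)) - - (?v * u\<^sub>x (x, t) + u\<^sub>t (x, t))) / d
      = - dq_source d (x, t)"
  proof -
    have "u\<^sub>t (x, t) = f (x, t) - ?v * u\<^sub>x (x, t) - b (x, t) * u (x, t)"
      "u\<^sub>t (x + d, t) = f (x + d, t) - a (x + d, t) * u\<^sub>x (x + d, t) - b (x + d, t) * u (x + d, t)"
      using pde[of "(x, t)"] pde[of "(x + d, t)"] assms by auto
    then have "- (?v * u\<^sub>x (x + d, t) + u\<^sub>t (x + d, t)) - - (?v * u\<^sub>x (x, t) + u\<^sub>t (x, t))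
        = - ((f (x + d, t) - f (x, t)) - (b (x + d, t) - b (x, t)) * u (x + d, t)
            - b (x, t) * (u (x + d, t) - u (x, t)) - (a (x + d, t) - ?v) * u\<^sub>x (x + d, t))"
      by (simp add: algebra_simps)
    moreover have "dq_source d (x, t)
        = ((f (x + d, t) - f (x, t)) - (b (x + d, t) - b (x, t)) * u (x + d, t)
            - b (x, t) * (u (x + d, t) - u (x, t)) - (a (x + d, t) - ?v) * u\<^sub>x (x + d, t)) / d"
      by (simp add: dq_source_def dq_def algebra_simps add_divide_distrib diff_divide_distrib)
    ultimately show ?thesis
      by (simp only: minus_divide_left)
  qed
  ultimately show ?thesis
    by (simp add: dq_def algebra_simps)
qed

lemma dq_source_bound:
  assumes "0 < d" "x \<in> {0..L - d}" "t \<in> {0..T}"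
  shows "\<bar>dq_source d (x, t)\<bar> \<le> K + 3 * K * K"
proof -
  have 1: "\<bar>p * q\<bar> \<le> K * K" if "\<bar>p\<bar> \<le> K" "\<bar>q\<bar> \<le> K" for p q
    using that by (simp add: abs_mult mult_mono)
  have in_box: "(x, t) \<in> {0..L} \<times> {0..T}" "(x + d, t) \<in> {0..L} \<times> {0..T}"
    using assms by auto
  have "\<bar>dq d f (x, t)\<bar> \<le> K" "\<bar>dq d b (x, t) * u (x + d, t)\<bar> \<le> K * K"
    "\<bar>b (x, t) * dq d u (x, t)\<bar> \<le> K * K" "\<bar>dq d a (x, t) * u\<^sub>x (x + d, t)\<bar> \<le> K * K"
    using assms by (intro dq_bound 1 bound in_box; simp)+
  then show ?thesis by (simp add: dq_source_def)
qed

text \<open>Replacing \<open>u\<^sub>x\<close> at the shifted points by \<open>dq d u\<close>, at the price of \<open>\<eta>\<close>, is what closes the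
estimate: a modulus of continuity of \<open>u\<^sub>x\<close> is the very thing to be proved, whereas a difference
of values of \<open>dq d u\<close> can be absorbed by the exponential factor in \<open>doubled_barrier\<close>.\<close>

lemma dq_source_difference:
  assumes "0 < d" "x \<in> {0..L - d}" "y \<in> {0..L - d}" "t \<in> {0..T}"
    and \<eta>: "\<And>z. z \<in> {x, y} \<Longrightarrow> \<bar>dq d u (z, t) - u\<^sub>x (z + d, t)\<bar> \<le> \<eta>"
  shows "\<bar>dq_source d (x, t) - dq_source d (y, t)\<bar>
    \<le> (K + 4 * K * K) * \<bar>x - y\<bar> + 2 * K * \<bar>dq d u (x, t) - dq d u (y, t)\<bar> + 2 * K * \<eta>"
proof -
  let ?r = "\<bar>x - y\<bar>" and ?q = "\<bar>dq d u (x, t) - dq d u (y, t)\<bar>"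
  have in_box: "(x, t) \<in> {0..L} \<times> {0..T}" "(x + d, t) \<in> {0..L} \<times> {0..T}"
    "(y, t) \<in> {0..L} \<times> {0..T}" "(y + d, t) \<in> {0..L} \<times> {0..T}"
    using assms by auto
  have "\<bar>dq d f (x, t) - dq d f (y, t)\<bar> \<le> K * ?r"
    using assms by (intro dq_Lipschitz) auto
  moreover have "\<bar>dq d b (x, t) * u (x + d, t) - dq d b (y, t) * u (y + d, t)\<bar> \<le> (K * ?r) * K + K * (K * ?r)"
    using assms in_box Lipschitz[of u "x + d" "y + d" t t]
    by (intro abs_mult_diff_le dq_Lipschitz dq_bound bound) auto
  moreover have "\<bar>b (x, t) * dq d u (x, t) - b (y, t) * dq d u (y, t)\<bar> \<le> (K * ?r) * K + K * ?q"
    using assms in_box Lipschitz[of b x y t t]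
    by (intro abs_mult_diff_le dq_bound bound) auto
  moreover have "\<bar>u\<^sub>x (x + d, t) - u\<^sub>x (y + d, t)\<bar> \<le> ?q + 2 * \<eta>"
    using \<eta>[of x, simplified] \<eta>[of y, simplified] by linarith
  then have "\<bar>dq d a (x, t) * u\<^sub>x (x + d, t) - dq d a (y, t) * u\<^sub>x (y + d, t)\<bar>
      \<le> (K * ?r) * K + K * (?q + 2 * \<eta>)"
    using assms(1-4) in_box
    by (intro abs_mult_diff_le dq_Lipschitz dq_bound bound) auto
  moreover have "\<bar>p - q - r - s - (p' - q' - r' - s')\<bar> \<le> A + B + C + D"
    if "\<bar>p - p'\<bar> \<le> A" "\<bar>q - q'\<bar> \<le> B" "\<bar>r - r'\<bar> \<le> C" "\<bar>s - s'\<bar> \<le> D"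
    for p q r s p' q' r' s' A B C D :: real
    using that unfolding abs_le_iff by linarith
  ultimately have "\<bar>dq_source d (x, t) - dq_source d (y, t)\<bar> \<le> K * ?r + ((K * ?r) * K + K * (K * ?r))
      + ((K * ?r) * K + K * ?q) + ((K * ?r) * K + K * (?q + 2 * \<eta>))"
    unfolding dq_source_def fst_conv snd_conv by blast
  also have "\<dots> = (K + 4 * K * K) * ?r + 2 * K * ?q + 2 * K * \<eta>"
    by (simp add: algebra_simps)
  finally show ?thesis .
qed

section \<open>Lipschitz continuity of the gradient\<close>

text \<open>At \<open>x = 0\<close> the equation reads \<open>a u\<^sub>x = f - b u - u\<^sub>t\<close>, where the right-hand side is Lipschitz
in time, and division by \<open>a \<ge> \<alpha>\<close> is harmless.\<close>

lemma inflow_slope_Lipschitz: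
  assumes "t \<in> {0..T}" "s \<in> {0..T}"
  shows "\<bar>u\<^sub>x (0, t) - u\<^sub>x (0, s)\<bar> \<le> (2 * K + 3 * K * K) / \<alpha> * \<bar>t - s\<bar>"
proof -
  have in_box: "(0, t) \<in> {0..L} \<times> {0..T}" "(0, s) \<in> {0..L} \<times> {0..T}"
    using assms pos by auto
  have f: "\<bar>f (0, t) - f (0, s)\<bar> \<le> K * \<bar>t - s\<bar>" and u: "\<bar>u (0, t) - u (0, s)\<bar> \<le> K * \<bar>t - s\<bar>"
    and a: "\<bar>a (0, t) - a (0, s)\<bar> \<le> K * \<bar>t - s\<bar>" and b: "\<bar>b (0, t) - b (0, s)\<bar> \<le> K * \<bar>t - s\<bar>"
    using Lipschitz[of _ 0 0 t s] assms pos by auto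
  have bu: "\<bar>b (0, t) * u (0, t) - b (0, s) * u (0, s)\<bar> \<le> (K * \<bar>t - s\<bar>) * K + K * (K * \<bar>t - s\<bar>)"
    using u b in_box by (intro abs_mult_diff_le bound) auto
  have au: "\<bar>(a (0, t) - a (0, s)) * u\<^sub>x (0, s)\<bar> \<le> (K * \<bar>t - s\<bar>) * K"
    unfolding abs_mult using a in_box K_nonneg by (intro mult_mono bound) auto
  have "a (0, t) * (u\<^sub>x (0, t) - u\<^sub>x (0, s)) = (f (0, t) - f (0, s))
      - (b (0, t) * u (0, t) - b (0, s) * u (0, s)) - (u\<^sub>t (0, t) - u\<^sub>t (0, s))
      - (a (0, t) - a (0, s)) * u\<^sub>x (0, s)"
    using pde[OF in_box(1)] pde[OF in_box(2)] by (simp add: algebra_simps)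
  moreover have "\<alpha> * \<bar>u\<^sub>x (0, t) - u\<^sub>x (0, s)\<bar> \<le> \<bar>a (0, t) * (u\<^sub>x (0, t) - u\<^sub>x (0, s))\<bar>"
    unfolding abs_mult using a_ge[OF in_box(1)] by (intro mult_right_mono) auto
  ultimately have "\<alpha> * \<bar>u\<^sub>x (0, t) - u\<^sub>x (0, s)\<bar> \<le> K * \<bar>t - s\<bar>
      + ((K * \<bar>t - s\<bar>) * K + K * (K * \<bar>t - s\<bar>)) + K * \<bar>t - s\<bar> + (K * \<bar>t - s\<bar>) * K"
    using f bu au inflow_Lipschitz[OF assms] by linarith
  also have "\<dots> = (2 * K + 3 * K * K) * \<bar>t - s\<bar>" by (simp add: algebra_simps)
  finally show ?thesis using pos by (simp add: field_simps)
qed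

text \<open>The slope is chosen so that \<open>inflow_barrier\<close> applies with the source bound
\<open>K + 3 K\<^sup>2\<close> and the Lipschitz constant of \<open>inflow_slope_Lipschitz\<close>, and so that it dominates
the slope \<open>K\<close> of the initial values.\<close>

definition barrier_slope :: real
  where "barrier_slope = K + (K + 3 * K * K + (2 * K + 3 * K * K) / \<alpha> + 1) / \<alpha>"

lemma barrier_slope_ge: "K \<le> barrier_slope" "K + 3 * K * K + (2 * K + 3 * K * K) / \<alpha> < barrier_slope * \<alpha>"
proof -
  show "K \<le> barrier_slope" unfolding barrier_slope_def using pos K_nonneg by (simp add: field_simps)
  have "barrier_slope * \<alpha> = K * \<alpha> + (K + 3 * K * K + (2 * K + 3 * K * K) / \<alpha> + 1)"
    unfolding barrier_slope_def distrib_right[of K] using pos by simp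
  moreover have "0 \<le> K * \<alpha>" using pos K_nonneg by simp
  ultimately show "K + 3 * K * K + (2 * K + 3 * K * K) / \<alpha> < barrier_slope * \<alpha>" by linarith
qed

lemma dq_near_inflow:
  assumes d: "0 < d" "d < L"
    and \<eta>: "\<And>t. t \<in> {0..T} \<Longrightarrow> \<bar>dq d u (0, t) - u\<^sub>x (0, t)\<bar> < \<eta>"
    and x: "x \<in> {0..L - d}" and t\<^sub>0: "t\<^sub>0 \<in> {0..T}"
  shows "\<bar>dq d u (x, t\<^sub>0) - u\<^sub>x (0, t\<^sub>0)\<bar> < \<eta> + barrier_slope * x"
proof -
  \<comment> \<open>The barrier bounds from above only; the sign \<open>\<sigma>\<close> yields the bound from below as well.\<close>
  have "\<sigma> * dq d u (x, t\<^sub>0) < (\<sigma> * u\<^sub>x (0, t\<^sub>0) + \<eta>) + (2 * K + 3 * K * K) / \<alpha> * (t\<^sub>0 - t\<^sub>0) + barrier_slope * x"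
    if \<sigma>: "\<sigma> = 1 \<or> \<sigma> = -1" for \<sigma>
  proof (rule inflow_barrier[where X = "L - d" and q = "\<lambda>p. \<sigma> * dq d u p" and t\<^sub>0 = t\<^sub>0 and a = a
        and G = "\<lambda>p. \<sigma> * dq_source d p" and \<alpha> = \<alpha> and \<Gamma> = "K + 3 * K * K"])
    show "continuous_on ({0..L - d} \<times> {0..t\<^sub>0}) (\<lambda>p. \<sigma> * dq d u p)"
      using t\<^sub>0 by (intro continuous_intros continuous_on_subset[OF dq_continuous[OF d(1)]]) auto
    show "((\<lambda>s. \<sigma> * dq d u (x - s * a (x, t), t - s)) has_real_derivative - (\<sigma> * dq_source d (x, t))) (at_right 0)"
      if "0 < x" "x \<le> L - d" "0 < t" "t \<le> t\<^sub>0" for x t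
      using DERIV_cmult[OF dq_transport[of d x t], of \<sigma>] that d t\<^sub>0 by simp
    show "\<sigma> * dq_source d (x, t) \<le> K + 3 * K * K" if "0 < x" "x \<le> L - d" "0 < t" "t \<le> t\<^sub>0" for x t
      using dq_source_bound[of d x t] that d t\<^sub>0 \<sigma> by (auto simp: abs_le_iff)
    show "\<alpha> \<le> a (x, t)" if "0 < x" "x \<le> L - d" "0 < t" "t \<le> t\<^sub>0" for x t
      using a_ge[of "(x, t)"] that d t\<^sub>0 by auto
    have slope: "\<sigma> * u\<^sub>x (0, t) \<le> \<sigma> * u\<^sub>x (0, t\<^sub>0) + (2 * K + 3 * K * K) / \<alpha> * (t\<^sub>0 - t)" if "t \<in> {0..t\<^sub>0}" for t
      using inflow_slope_Lipschitz[of t t\<^sub>0] that t\<^sub>0 \<sigma> by (auto simp: abs_le_iff)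
    have near: "\<sigma> * dq d u (0, t) < \<sigma> * u\<^sub>x (0, t) + \<eta>" if "t \<in> {0..t\<^sub>0}" for t
      using \<eta>[of t] that t\<^sub>0 \<sigma> by (auto simp: abs_less_iff)
    show "\<sigma> * dq d u (0, t) < \<sigma> * u\<^sub>x (0, t\<^sub>0) + \<eta> + (2 * K + 3 * K * K) / \<alpha> * (t\<^sub>0 - t)" if "t \<in> {0..t\<^sub>0}" for t
      using slope[OF that] near[OF that] by linarith
    show "\<sigma> * dq d u (x, 0) < \<sigma> * u\<^sub>x (0, t\<^sub>0) + \<eta> + (2 * K + 3 * K * K) / \<alpha> * t\<^sub>0 + barrier_slope * x"
      if "x \<in> {0..L - d}" for x
    proof -
      have "\<bar>dq d u (x, 0) - dq d u (0, 0)\<bar> \<le> K * \<bar>x - 0\<bar>"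
        using that d t\<^sub>0 by (intro dq_Lipschitz) auto
      also have "\<dots> \<le> barrier_slope * x"
        using that barrier_slope_ge(1) by (auto intro: mult_right_mono)
      finally have "\<sigma> * dq d u (x, 0) - \<sigma> * dq d u (0, 0) \<le> barrier_slope * x"
        using \<sigma> by (auto simp: abs_le_iff)
      then show ?thesis using slope[of 0] near[of 0] t\<^sub>0 by auto
    qed
    show "0 \<le> barrier_slope" using barrier_slope_ge K_nonneg by linarith
    show "K + 3 * K * K + (2 * K + 3 * K * K) / \<alpha> < barrier_slope * \<alpha>" by (fact barrier_slope_ge)
  qed (use pos x t\<^sub>0 in auto)
  from this[of 1] this[of "-1"] show ?thesis by (auto simp: abs_less_iff)
qed

text \<open>The constant \<open>\<Lambda>\<close> does not depend on \<open>\<epsilon>\<close> or \<open>d\<close>; \<open>\<epsilon>\<close> makes room for the error of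
\<open>dq d u\<close> as an approximation of \<open>u\<^sub>x\<close>, and is removed in the limit.\<close>

lemma dq_almost_Lipschitz:
  "\<exists>\<Lambda>\<ge>0. \<forall>\<epsilon>>0. \<exists>d\<^sub>0>0. \<forall>d x y t. 0 < d \<longrightarrow> d < d\<^sub>0 \<longrightarrow>
    x \<in> {0..L - d} \<longrightarrow> y \<in> {0..L - d} \<longrightarrow> t \<in> {0..T} \<longrightarrow>
    \<bar>dq d u (x, t) - dq d u (y, t)\<bar> \<le> \<Lambda> * (\<bar>x - y\<bar> + \<epsilon>)"
proof -
  \<comment> \<open>Large enough for the initial values and the source (\<open>K + 4 * K * K\<close>), for the inflow barrier, and
    for the approximation errors, which are absorbed by \<open>\<rho> * \<epsilon> \<ge> \<epsilon>\<close>.\<close>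
  define \<rho> where "\<rho> = K + 4 * K * K + barrier_slope + 1"
  define \<Lambda> where "\<Lambda> = \<rho> * exp ((K + 2 * K + 1) * T)"
  have nonneg: "0 \<le> K" "0 \<le> K * K" "0 \<le> barrier_slope" using K_nonneg barrier_slope_ge by auto
  have \<rho>: "0 \<le> \<rho>" "barrier_slope \<le> \<rho>" "K + 4 * K * K \<le> \<rho>" "K \<le> \<rho>" "1 \<le> \<rho>"
    using nonneg by (auto simp: \<rho>_def)
  have "\<exists>d\<^sub>0>0. \<forall>d x y t. 0 < d \<longrightarrow> d < d\<^sub>0 \<longrightarrow>
    x \<in> {0..L - d} \<longrightarrow> y \<in> {0..L - d} \<longrightarrow> t \<in> {0..T} \<longrightarrow>
    \<bar>dq d u (x, t) - dq d u (y, t)\<bar> \<le> \<Lambda> * (\<bar>x - y\<bar> + \<epsilon>)" if \<epsilon>: "0 < \<epsilon>" for \<epsilon>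
  proof -
    obtain d\<^sub>0 where d\<^sub>0: "0 < d\<^sub>0" "\<And>d x t. 0 < d \<Longrightarrow> d < d\<^sub>0 \<Longrightarrow> x \<in> {0..L - d} \<Longrightarrow> t \<in> {0..T} \<Longrightarrow>
        \<bar>dq d u (x, t) - u\<^sub>x (x, t)\<bar> < \<epsilon> / 4 \<and> \<bar>dq d u (x, t) - u\<^sub>x (x + d, t)\<bar> < \<epsilon> / 4"
      using dq_approximates[of "\<epsilon> / 4"] \<epsilon> by auto
    have ordered: "\<sigma> * dq d u (x, t) - \<sigma> * dq d u (y, t) \<le> \<Lambda> * (x - y + \<epsilon>)"
      if d: "0 < d" "d < min d\<^sub>0 L" and xy: "0 \<le> y" "y \<le> x" "x \<le> L - d" and t: "t \<in> {0..T}"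
        and \<sigma>: "\<sigma> = 1 \<or> \<sigma> = -1" for d x y t \<sigma>
    proof -
      have "\<epsilon> \<le> \<rho> * \<epsilon>" "K * \<epsilon> \<le> \<rho> * \<epsilon>"
        using \<rho> \<epsilon> by (auto simp: mult_le_cancel_right1)
      have "\<sigma> * dq d u (x, t) - \<sigma> * dq d u (y, t) < \<rho> * exp ((K + 2 * K + 1) * t) * (x - y + \<epsilon>)"
      proof (rule doubled_barrier[where X = "L - d" and T = T and q = "\<lambda>p. \<sigma> * dq d u p" and a = a
            and G = "\<lambda>p. \<sigma> * dq_source d p" and \<eta> = "2 * K * (\<epsilon> / 4)"])
        show "continuous_on ({0..L - d} \<times> {0..T}) (\<lambda>p. \<sigma> * dq d u p)"
          by (intro continuous_intros dq_continuous d)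
        show "((\<lambda>s. \<sigma> * dq d u (x - s * a (x, t), t - s)) has_real_derivative - (\<sigma> * dq_source d (x, t))) (at_right 0)"
          if "0 < x" "x \<le> L - d" "0 < t" "t \<le> T" for x t
          using DERIV_cmult[OF dq_transport[of d x t], of \<sigma>] that d by simp
        show "\<sigma> * dq_source d (x, t) - \<sigma> * dq_source d (y, t)
            \<le> \<rho> * (x - y) + (2 * K) * \<bar>\<sigma> * dq d u (x, t) - \<sigma> * dq d u (y, t)\<bar> + 2 * K * (\<epsilon> / 4)"
          if "0 < y" "y < x" "x \<le> L - d" "0 < t" "t \<le> T" for x y t
        proof -
          have "\<bar>dq_source d (x, t) - dq_source d (y, t)\<bar>
            \<le> (K + 4 * K * K) * \<bar>x - y\<bar> + 2 * K * \<bar>dq d u (x, t) - dq d u (y, t)\<bar> + 2 * K * (\<epsilon> / 4)"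
            using that d d\<^sub>0(2)[of d x t] d\<^sub>0(2)[of d y t] by (intro dq_source_difference) auto
          moreover have "(K + 4 * K * K) * \<bar>x - y\<bar> \<le> \<rho> * (x - y)"
            using \<rho> that by (simp add: mult_right_mono)
          moreover have same: "\<bar>\<sigma> * dq d u (x, t) - \<sigma> * dq d u (y, t)\<bar> = \<bar>dq d u (x, t) - dq d u (y, t)\<bar>"
            using \<sigma> by auto
          moreover have "\<sigma> * dq_source d (x, t) - \<sigma> * dq_source d (y, t) \<le> \<bar>dq_source d (x, t) - dq_source d (y, t)\<bar>"
            using \<sigma> by auto
          ultimately show ?thesis unfolding same by linarith
        qed
        show "0 < a (x, t)" if "0 < x" "x \<le> L - d" "0 < t" "t \<le> T" for x t
          using a_ge[of "(x, t)"] that d pos by auto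
        show "\<bar>a (x, t) - a (y, t)\<bar> \<le> K * (x - y)"
          if "0 < y" "y < x" "x \<le> L - d" "0 < t" "t \<le> T" for x y t
          using Lipschitz[of a x y t t] that d by auto
        show "\<sigma> * dq d u (x, t) - \<sigma> * dq d u (0, t) < \<rho> * (x + \<epsilon>)"
          if "x \<in> {0..L - d}" "t \<in> {0..T}" for x t
        proof -
          have "\<bar>dq d u (x, t) - u\<^sub>x (0, t)\<bar> < \<epsilon> / 4 + barrier_slope * x"
            using that d d\<^sub>0(2)[of d 0] by (intro dq_near_inflow) auto
          moreover have "\<bar>dq d u (0, t) - u\<^sub>x (0, t)\<bar> < \<epsilon> / 4"
            using that d d\<^sub>0(2)[of d 0 t] by auto
          moreover have "barrier_slope * x \<le> \<rho> * x"
            using \<rho> that by (intro mult_right_mono) auto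
          moreover have "\<rho> * (x + \<epsilon>) = \<rho> * x + \<rho> * \<epsilon>" by (simp add: algebra_simps)
          moreover have "\<sigma> * dq d u (x, t) - \<sigma> * dq d u (0, t)
              \<le> \<bar>dq d u (x, t) - u\<^sub>x (0, t)\<bar> + \<bar>dq d u (0, t) - u\<^sub>x (0, t)\<bar>"
            using \<sigma> by auto
          ultimately show ?thesis using \<open>\<epsilon> \<le> \<rho> * \<epsilon>\<close> \<epsilon> by linarith
        qed
        show "\<sigma> * dq d u (x, 0) - \<sigma> * dq d u (y, 0) < \<rho> * (x - y + \<epsilon>)"
          if "0 \<le> y" "y \<le> x" "x \<le> L - d" for x y
        proof -
          have "\<bar>dq d u (x, 0) - dq d u (y, 0)\<bar> \<le> K * \<bar>x - y\<bar>"
            using that d pos by (intro dq_Lipschitz) auto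
          moreover have "K * \<bar>x - y\<bar> \<le> \<rho> * (x - y)"
            using \<rho> that by (simp add: mult_right_mono)
          moreover have "\<rho> * (x - y + \<epsilon>) = \<rho> * (x - y) + \<rho> * \<epsilon>" by (simp add: algebra_simps)
          moreover have "\<sigma> * dq d u (x, 0) - \<sigma> * dq d u (y, 0) \<le> \<bar>dq d u (x, 0) - dq d u (y, 0)\<bar>"
            using \<sigma> by auto
          ultimately show ?thesis using \<open>\<epsilon> \<le> \<rho> * \<epsilon>\<close> \<epsilon> by linarith
        qed
        show "2 * K * (\<epsilon> / 4) < \<rho> * \<epsilon>"
          using \<open>\<epsilon> \<le> \<rho> * \<epsilon>\<close> \<open>K * \<epsilon> \<le> \<rho> * \<epsilon>\<close> \<epsilon> by simp
      qed (use nonneg \<rho> \<epsilon> xy t in auto)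
      also have "\<dots> \<le> \<Lambda> * (x - y + \<epsilon>)"
        unfolding \<Lambda>_def using \<rho> xy \<epsilon> t nonneg by (intro mult_mono) auto
      finally show ?thesis by simp
    qed
    have "\<bar>dq d u (x, t) - dq d u (y, t)\<bar> \<le> \<Lambda> * (\<bar>x - y\<bar> + \<epsilon>)"
      if d: "0 < d" "d < min d\<^sub>0 L" and "x \<in> {0..L - d}" "y \<in> {0..L - d}" and t: "t \<in> {0..T}" for d x y t
    proof (cases "y \<le> x")
      case True
      then show ?thesis
        using ordered[of d y x t 1] ordered[of d y x t "-1"] that by (auto simp: abs_le_iff)
    next
      case False
      then show ?thesis
        using ordered[of d x y t 1] ordered[of d x y t "-1"] that by (auto simp: abs_le_iff)
    qed
    then show ?thesis
      using d\<^sub>0(1) pos by (intro exI[of _ "min d\<^sub>0 L"]) auto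
  qed
  moreover have "0 \<le> \<Lambda>" using \<rho> by (simp add: \<Lambda>_def)
  ultimately show ?thesis by blast
qed

text \<open>The quotient \<open>dq d u\<close> lives on \<open>x \<le> L - d\<close> only. It approximates \<open>u\<^sub>x\<close> at both ends of its
stencil, so points close to \<open>L\<close> are reached by shifting the stencil to the left; the same point
\<open>z\<close> serves all times.\<close>

lemma u\<^sub>x_near_dq:
  assumes "0 < \<eta>"
  shows "\<exists>d\<^sub>0>0. \<forall>d x. 0 < d \<longrightarrow> d < d\<^sub>0 \<longrightarrow> x \<in> {0..L} \<longrightarrow>
    (\<exists>z\<in>{0..L - d}. \<bar>z - x\<bar> \<le> d \<and> (\<forall>t\<in>{0..T}. \<bar>dq d u (z, t) - u\<^sub>x (x, t)\<bar> < \<eta>))"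
proof -
  obtain d\<^sub>0 where d\<^sub>0: "0 < d\<^sub>0" "\<And>d x t. 0 < d \<Longrightarrow> d < d\<^sub>0 \<Longrightarrow> x \<in> {0..L - d} \<Longrightarrow> t \<in> {0..T} \<Longrightarrow>
      \<bar>dq d u (x, t) - u\<^sub>x (x, t)\<bar> < \<eta> \<and> \<bar>dq d u (x, t) - u\<^sub>x (x + d, t)\<bar> < \<eta>"
    using dq_approximates[OF assms] by auto
  have "\<exists>z\<in>{0..L - d}. \<bar>z - x\<bar> \<le> d \<and> (\<forall>t\<in>{0..T}. \<bar>dq d u (z, t) - u\<^sub>x (x, t)\<bar> < \<eta>)"
    if "0 < d" "d < min d\<^sub>0 (L / 2)" "x \<in> {0..L}" for d x
  proof (cases "x \<le> L - d")
    case True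
    then show ?thesis using d\<^sub>0(2)[of d x] that by (intro bexI[of _ x]) auto
  next
    case False
    then show ?thesis using d\<^sub>0(2)[of d "x - d"] that by (intro bexI[of _ "x - d"]) auto
  qed
  then show ?thesis
    using d\<^sub>0(1) pos by (intro exI[of _ "min d\<^sub>0 (L / 2)"]) auto
qed

lemma u\<^sub>x_Lipschitz_x:
  "\<exists>\<Lambda>\<ge>0. \<forall>x\<in>{0..L}. \<forall>y\<in>{0..L}. \<forall>t\<in>{0..T}. \<bar>u\<^sub>x (x, t) - u\<^sub>x (y, t)\<bar> \<le> \<Lambda> * \<bar>x - y\<bar>"
proof -
  obtain \<Lambda> where \<Lambda>: "0 \<le> \<Lambda>" "\<forall>\<epsilon>>0. \<exists>d\<^sub>0>0. \<forall>d x y t. 0 < d \<longrightarrow> d < d\<^sub>0 \<longrightarrow>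
    x \<in> {0..L - d} \<longrightarrow> y \<in> {0..L - d} \<longrightarrow> t \<in> {0..T} \<longrightarrow>
    \<bar>dq d u (x, t) - dq d u (y, t)\<bar> \<le> \<Lambda> * (\<bar>x - y\<bar> + \<epsilon>)"
    using dq_almost_Lipschitz by blast
  have "\<bar>u\<^sub>x (x, t) - u\<^sub>x (y, t)\<bar> \<le> \<Lambda> * \<bar>x - y\<bar>"
    if xy: "x \<in> {0..L}" "y \<in> {0..L}" and t: "t \<in> {0..T}" for x y t
  proof (rule field_le_epsilon)
    fix e :: real assume "0 < e"
    \<comment> \<open>Moving the two points to the domain of \<open>dq\<close> costs \<open>2 d \<le> 2 \<epsilon>\<close> in the distance, the
      almost-Lipschitz bound another \<open>\<epsilon>\<close>, and each replacement of \<open>u\<^sub>x\<close> by \<open>dq d u\<close> an \<open>\<epsilon>\<close>.\<close>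
    define \<epsilon> where "\<epsilon> = e / (3 * \<Lambda> + 2)"
    have "0 < 3 * \<Lambda> + 2" using \<Lambda>(1) by simp
    then have "0 < \<epsilon>" "\<epsilon> * (3 * \<Lambda> + 2) = e"
      using \<open>0 < e\<close> by (auto simp: \<epsilon>_def)
    then have \<epsilon>: "0 < \<epsilon>" "3 * (\<Lambda> * \<epsilon>) + 2 * \<epsilon> = e"
      by (auto simp: algebra_simps)
    obtain d\<^sub>1 where d\<^sub>1: "0 < d\<^sub>1" "\<And>d x y t. 0 < d \<Longrightarrow> d < d\<^sub>1 \<Longrightarrow>
        x \<in> {0..L - d} \<Longrightarrow> y \<in> {0..L - d} \<Longrightarrow> t \<in> {0..T} \<Longrightarrow>
        \<bar>dq d u (x, t) - dq d u (y, t)\<bar> \<le> \<Lambda> * (\<bar>x - y\<bar> + \<epsilon>)"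
      using \<Lambda>(2) \<epsilon>(1) by meson
    obtain d\<^sub>2 where d\<^sub>2: "0 < d\<^sub>2" "\<And>d x. 0 < d \<Longrightarrow> d < d\<^sub>2 \<Longrightarrow> x \<in> {0..L} \<Longrightarrow>
        \<exists>z\<in>{0..L - d}. \<bar>z - x\<bar> \<le> d \<and> (\<forall>t\<in>{0..T}. \<bar>dq d u (z, t) - u\<^sub>x (x, t)\<bar> < \<epsilon>)"
      using u\<^sub>x_near_dq[OF \<epsilon>(1)] by meson
    define d where "d = min (min d\<^sub>1 d\<^sub>2) \<epsilon> / 2"
    have d: "0 < d" "d < d\<^sub>1" "d < d\<^sub>2" "d \<le> \<epsilon>"
      using d\<^sub>1(1) d\<^sub>2(1) \<epsilon> by (auto simp: d_def)
    obtain x' y' where x': "x' \<in> {0..L - d}" "\<bar>x' - x\<bar> \<le> d" "\<bar>dq d u (x', t) - u\<^sub>x (x, t)\<bar> < \<epsilon>"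
      and y': "y' \<in> {0..L - d}" "\<bar>y' - y\<bar> \<le> d" "\<bar>dq d u (y', t) - u\<^sub>x (y, t)\<bar> < \<epsilon>"
      using d\<^sub>2(2)[OF d(1,3) xy(1)] d\<^sub>2(2)[OF d(1,3) xy(2)] t by blast
    have "\<bar>dq d u (x', t) - dq d u (y', t)\<bar> \<le> \<Lambda> * (\<bar>x' - y'\<bar> + \<epsilon>)"
      using d\<^sub>1(2) d x' y' t by blast
    also have "\<dots> \<le> \<Lambda> * (\<bar>x - y\<bar> + 3 * \<epsilon>)"
      using x'(2) y'(2) d(4) \<Lambda>(1) by (intro mult_left_mono) linarith+
    also have "\<dots> = \<Lambda> * \<bar>x - y\<bar> + 3 * (\<Lambda> * \<epsilon>)" by (simp add: algebra_simps)
    finally show "\<bar>u\<^sub>x (x, t) - u\<^sub>x (y, t)\<bar> \<le> \<Lambda> * \<bar>x - y\<bar> + e"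
      using x'(3) y'(3) \<epsilon>(2) by linarith
  qed
  then show ?thesis using \<Lambda>(1) by blast
qed

lemma u\<^sub>t_difference:
  assumes "x \<in> {0..L}" "y \<in> {0..L}" "t \<in> {0..T}" "s \<in> {0..T}"
  shows "\<bar>u\<^sub>t (x, t) - u\<^sub>t (y, s)\<bar>
    \<le> (K + 3 * K * K) * (\<bar>x - y\<bar> + \<bar>t - s\<bar>) + K * \<bar>u\<^sub>x (x, t) - u\<^sub>x (y, s)\<bar>"
proof -
  let ?r = "\<bar>x - y\<bar> + \<bar>t - s\<bar>"
  have in_box: "(x, t) \<in> {0..L} \<times> {0..T}" "(y, s) \<in> {0..L} \<times> {0..T}"
    using assms by auto
  have Lip: "\<bar>g (x, t) - g (y, s)\<bar> \<le> K * ?r" if "g \<in> {a, b, f, u}" for g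
    using assms that by (intro Lipschitz)
  have f: "\<bar>f (x, t) - f (y, s)\<bar> \<le> K * ?r" by (intro Lip) simp
  have bu: "\<bar>b (x, t) * u (x, t) - b (y, s) * u (y, s)\<bar> \<le> (K * ?r) * K + K * (K * ?r)"
    using in_box by (intro abs_mult_diff_le bound Lip) auto
  have au: "\<bar>a (x, t) * u\<^sub>x (x, t) - a (y, s) * u\<^sub>x (y, s)\<bar>
      \<le> (K * ?r) * K + K * \<bar>u\<^sub>x (x, t) - u\<^sub>x (y, s)\<bar>"
    using in_box by (intro abs_mult_diff_le bound Lip) auto
  have "u\<^sub>t (x, t) - u\<^sub>t (y, s) = (f (x, t) - f (y, s)) - (b (x, t) * u (x, t) - b (y, s) * u (y, s))
      - (a (x, t) * u\<^sub>x (x, t) - a (y, s) * u\<^sub>x (y, s))"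
    using pde[OF in_box(1)] pde[OF in_box(2)] by simp
  also have "\<bar>\<dots>\<bar> \<le> K * ?r + ((K * ?r) * K + K * (K * ?r)) + ((K * ?r) * K + K * \<bar>u\<^sub>x (x, t) - u\<^sub>x (y, s)\<bar>)"
    using f bu au by linarith
  also have "\<dots> = (K + 3 * K * K) * ?r + K * \<bar>u\<^sub>x (x, t) - u\<^sub>x (y, s)\<bar>"
    by (simp add: algebra_simps)
  finally show ?thesis .
qed

text \<open>The order of differencing in space and time is interchanged here, which gives access to
the time increments of \<open>dq d u\<close> through the space increments of \<open>u\<^sub>t\<close>.\<close>

lemma u_mixed_difference:
  assumes M: "\<And>x y t. x \<in> {0..L} \<Longrightarrow> y \<in> {0..L} \<Longrightarrow> t \<in> {0..T} \<Longrightarrow> \<bar>u\<^sub>t (x, t) - u\<^sub>t (y, t)\<bar> \<le> M * \<bar>x - y\<bar>"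
    and "x \<in> {0..L}" "y \<in> {0..L}" "t \<in> {0..T}" "s \<in> {0..T}"
  shows "\<bar>(u (x, t) - u (y, t)) - (u (x, s) - u (y, s))\<bar> \<le> M * \<bar>x - y\<bar> * \<bar>t - s\<bar>"
proof -
  have "norm ((u (x, t) - u (y, t)) - (u (x, s) - u (y, s))) \<le> M * \<bar>x - y\<bar> * norm (t - s)"
    using assms by (intro field_differentiable_bound[where S = "{0..T}" and f = "\<lambda>t. u (x, t) - u (y, t)"
          and f' = "\<lambda>t. u\<^sub>t (x, t) - u\<^sub>t (y, t)"] DERIV_diff u_partial_derivatives(2) M[simplified]) auto
  then show ?thesis by simp
qed

theorem gradient_Lipschitz:
  "\<exists>\<Lambda>\<ge>0. \<forall>x\<in>{0..L}. \<forall>y\<in>{0..L}. \<forall>t\<in>{0..T}. \<forall>s\<in>{0..T}.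
    \<bar>u\<^sub>x (x, t) - u\<^sub>x (y, s)\<bar> \<le> \<Lambda> * (\<bar>x - y\<bar> + \<bar>t - s\<bar>) \<and>
    \<bar>u\<^sub>t (x, t) - u\<^sub>t (y, s)\<bar> \<le> \<Lambda> * (\<bar>x - y\<bar> + \<bar>t - s\<bar>)"
proof -
  obtain \<Lambda> where \<Lambda>: "0 \<le> \<Lambda>" "\<And>x y t. x \<in> {0..L} \<Longrightarrow> y \<in> {0..L} \<Longrightarrow> t \<in> {0..T} \<Longrightarrow>
      \<bar>u\<^sub>x (x, t) - u\<^sub>x (y, t)\<bar> \<le> \<Lambda> * \<bar>x - y\<bar>"
    using u\<^sub>x_Lipschitz_x by blast
  define M where "M = K + 3 * K * K + K * \<Lambda>"
  have M_nonneg: "0 \<le> M" "K + 3 * K * K \<ge> 0" using K_nonneg \<Lambda>(1) by (auto simp: M_def)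
  have u\<^sub>t_x: "\<bar>u\<^sub>t (x, t) - u\<^sub>t (y, t)\<bar> \<le> M * \<bar>x - y\<bar>"
    if "x \<in> {0..L}" "y \<in> {0..L}" "t \<in> {0..T}" for x y t
  proof -
    have "K * \<bar>u\<^sub>x (x, t) - u\<^sub>x (y, t)\<bar> \<le> K * (\<Lambda> * \<bar>x - y\<bar>)"
      using \<Lambda>(2)[OF that] K_nonneg by (rule mult_left_mono)
    then show ?thesis
      using u\<^sub>t_difference[OF that that(3)] by (simp add: M_def algebra_simps)
  qed
  have u\<^sub>x_t: "\<bar>u\<^sub>x (x, t) - u\<^sub>x (x, s)\<bar> \<le> M * \<bar>t - s\<bar>"
    if x: "x \<in> {0..L}" and ts: "t \<in> {0..T}" "s \<in> {0..T}" for x t s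
  proof (rule field_le_epsilon)
    fix e :: real assume "0 < e"
    then obtain d\<^sub>0 where d\<^sub>0: "0 < d\<^sub>0" "\<And>d x. 0 < d \<Longrightarrow> d < d\<^sub>0 \<Longrightarrow> x \<in> {0..L} \<Longrightarrow>
        \<exists>z\<in>{0..L - d}. \<bar>z - x\<bar> \<le> d \<and> (\<forall>t\<in>{0..T}. \<bar>dq d u (z, t) - u\<^sub>x (x, t)\<bar> < e / 2)"
      using u\<^sub>x_near_dq[of "e / 2"] by (auto; meson)
    define d where "d = d\<^sub>0 / 2"
    have d: "0 < d" "d < d\<^sub>0" using d\<^sub>0(1) by (auto simp: d_def)
    obtain z where z: "z \<in> {0..L - d}" "\<And>t. t \<in> {0..T} \<Longrightarrow> \<bar>dq d u (z, t) - u\<^sub>x (x, t)\<bar> < e / 2"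
      using d\<^sub>0(2)[OF d x] by blast
    have "\<bar>(u (z + d, t) - u (z, t)) - (u (z + d, s) - u (z, s))\<bar> \<le> M * \<bar>z + d - z\<bar> * \<bar>t - s\<bar>"
      using z(1) d ts by (intro u_mixed_difference u\<^sub>t_x) auto
    moreover have "dq d u (z, t) - dq d u (z, s) = ((u (z + d, t) - u (z, t)) - (u (z + d, s) - u (z, s))) / d"
      by (simp add: dq_def diff_divide_distrib)
    ultimately have "\<bar>dq d u (z, t) - dq d u (z, s)\<bar> \<le> M * \<bar>t - s\<bar>"
      using d by (simp add: abs_divide divide_le_eq mult_ac)
    then show "\<bar>u\<^sub>x (x, t) - u\<^sub>x (x, s)\<bar> \<le> M * \<bar>t - s\<bar> + e"
      using z(2)[OF ts(1)] z(2)[OF ts(2)] by linarith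
  qed
  define \<Theta> where "\<Theta> = \<Lambda> + M + (K + 3 * K * K) + K * (\<Lambda> + M)"
  have KM: "0 \<le> K * (\<Lambda> + M)" using K_nonneg \<Lambda>(1) M_nonneg by simp
  have "\<bar>u\<^sub>x (x, t) - u\<^sub>x (y, s)\<bar> \<le> \<Theta> * (\<bar>x - y\<bar> + \<bar>t - s\<bar>) \<and>
    \<bar>u\<^sub>t (x, t) - u\<^sub>t (y, s)\<bar> \<le> \<Theta> * (\<bar>x - y\<bar> + \<bar>t - s\<bar>)"
    if "x \<in> {0..L}" "y \<in> {0..L}" "t \<in> {0..T}" "s \<in> {0..T}" for x y t s
  proof -
    let ?r = "\<bar>x - y\<bar> + \<bar>t - s\<bar>"
    have "\<Lambda> * \<bar>x - y\<bar> \<le> \<Lambda> * ?r" "M * \<bar>t - s\<bar> \<le> M * ?r"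
      using \<Lambda>(1) M_nonneg by (auto intro: mult_left_mono)
    then have ux: "\<bar>u\<^sub>x (x, t) - u\<^sub>x (y, s)\<bar> \<le> (\<Lambda> + M) * ?r"
      unfolding distrib_right[of \<Lambda>] using \<Lambda>(2)[OF that(1-3)] u\<^sub>x_t[OF that(2-4)] by linarith
    then have "K * \<bar>u\<^sub>x (x, t) - u\<^sub>x (y, s)\<bar> \<le> K * ((\<Lambda> + M) * ?r)"
      using K_nonneg by (rule mult_left_mono)
    then have "\<bar>u\<^sub>t (x, t) - u\<^sub>t (y, s)\<bar> \<le> ((K + 3 * K * K) + K * (\<Lambda> + M)) * ?r"
      unfolding distrib_right[of "K + 3 * K * K"] using u\<^sub>t_difference[OF that] by (simp only: mult.assoc)
    moreover have "(\<Lambda> + M) * ?r \<le> \<Theta> * ?r" "((K + 3 * K * K) + K * (\<Lambda> + M)) * ?r \<le> \<Theta> * ?r"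
      using \<Lambda>(1) M_nonneg KM by (auto simp: \<Theta>_def intro!: mult_right_mono)
    ultimately show ?thesis using ux by linarith
  qed
  moreover have "0 \<le> \<Theta>" using \<Lambda>(1) M_nonneg KM by (simp add: \<Theta>_def)
  ultimately show ?thesis by blast
qed

end

section \<open>Meshes, the upwind scheme and bilinear interpolation\<close>

lemma mesh_mono:
  assumes "mesh L C N x" "i \<le> j" "j \<le> N"
  shows "x i \<le> x j"
  using assms(2,3)
proof (induction j rule: dec_induct)
  case (step n)
  then have "x (Suc n - 1) < x (Suc n)"
    using assms(1) unfolding mesh_def by (metis Suc_leI atLeastAtMost_iff le_add1 plus_1_eq_Suc)
  then show ?case using step by simp
qed simp

lemma mesh_in:
  assumes "mesh L C N x" "i \<le> N"
  shows "x i \<in> {0..L}"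
  using mesh_mono[OF assms(1), of 0 i] mesh_mono[OF assms(1), of i N] assms by (simp add: mesh_def)

lemma mesh_step:
  assumes "mesh L C N x" "i \<in> {1..N}"
  shows "x (i - 1) < x i" "x i - x (i - 1) \<le> C / real N"
    "x (i - 1) \<in> {0..L}" "x i \<in> {0..L}"
  using assms mesh_in[OF assms(1), of i] mesh_in[OF assms(1), of "i - 1"] unfolding mesh_def by auto

lemma mesh_cover:
  assumes "mesh L C N x" "z \<in> {0..L}"
  shows "\<exists>i\<in>{1..N}. z \<in> {x (i - 1)..x i}"
proof -
  have N: "0 < N" "x 0 = 0" "x N = L" using assms(1) by (auto simp: mesh_def)
  define i where "i = (LEAST i. 1 \<le> i \<and> z \<le> x i)"
  have i: "1 \<le> i \<and> z \<le> x i"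
    unfolding i_def by (rule LeastI[of _ N]) (use N assms(2) in auto)
  have "i \<le> N"
    unfolding i_def by (rule Least_le) (use N assms(2) in auto)
  moreover have "x (i - 1) \<le> z"
  proof (cases "i = 1")
    case True
    then show ?thesis using N assms(2) by simp
  next
    case False
    then show ?thesis
      using not_less_Least[of "i - 1" "\<lambda>i. 1 \<le> i \<and> z \<le> x i", folded i_def] i by auto
  qed
  ultimately show ?thesis using i by auto
qed

text \<open>Solved for the newest value, the scheme expresses \<open>(1/k + A/h + B) e i j\<close> by the residual and a
combination of \<open>e i (j - 1)\<close> and \<open>e (i - 1) j\<close> with the nonnegative weights \<open>1/k\<close> and
\<open>A/h\<close>. As \<open>B \<ge> 0\<close>, the function \<open>\<tau> t\<close> is a discrete supersolution, for every mesh ratio.\<close>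

lemma upwind_stability:
  fixes e :: "nat \<Rightarrow> nat \<Rightarrow> real"
  assumes x: "mesh L C N x" and t: "mesh T C M t"
    and A: "\<And>i j. i \<in> {1..N} \<Longrightarrow> j \<in> {1..M} \<Longrightarrow> 0 \<le> A i j"
    and B: "\<And>i j. i \<in> {1..N} \<Longrightarrow> j \<in> {1..M} \<Longrightarrow> 0 \<le> B i j"
    and residual: "\<And>i j. i \<in> {1..N} \<Longrightarrow> j \<in> {1..M} \<Longrightarrow>
      \<bar>Dt_minus t e i j + A i j * Dx_minus x e i j + B i j * e i j\<bar> \<le> \<tau>"
    and inflow: "\<And>j. j \<in> {1..M} \<Longrightarrow> e 0 j = 0"
    and init: "\<And>i. i \<le> N \<Longrightarrow> e i 0 = 0"
    and "0 \<le> \<tau>" "i \<le> N" "j \<le> M"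
  shows "\<bar>e i j\<bar> \<le> \<tau> * t j"
  using \<open>i \<le> N\<close> \<open>j \<le> M\<close>
proof (induction j arbitrary: i)
  case 0
  then show ?case using init[of i] t by (simp add: mesh_def)
next
  case (Suc j)
  have level: "\<bar>e i' j\<bar> \<le> \<tau> * t j" if "i' \<le> N" for i'
    using Suc that by simp
  show ?case using \<open>i \<le> N\<close>
  proof (induction i)
    case 0
    then show ?case
      using inflow[of "Suc j"] mesh_in[OF t, of "Suc j"] \<open>Suc j \<le> M\<close> \<open>0 \<le> \<tau>\<close> by simp
  next
    case (Suc i)
    let ?i = "Suc i" and ?j = "Suc j"
    have ij: "?i \<in> {1..N}" "?j \<in> {1..M}" using Suc.prems \<open>?j \<le> M\<close> by auto
    define k where "k = t ?j - t j"
    define p where "p = 1 / k"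
    define q where "q = A ?i ?j / (x ?i - x i)"
    have "0 < k" using mesh_step(1)[OF t ij(2)] by (simp add: k_def)
    then have p: "0 < p" "p * k = 1" by (auto simp: p_def)
    have q: "0 \<le> q" using mesh_step(1)[OF x ij(1)] A[OF ij] by (simp add: q_def)
    define R where "R = Dt_minus t e ?i ?j + A ?i ?j * Dx_minus x e ?i ?j + B ?i ?j * e ?i ?j"
    have R: "\<bar>R\<bar> \<le> \<tau>" unfolding R_def by (rule residual[OF ij])
    have "R = p * (e ?i ?j - e ?i j) + q * (e ?i ?j - e i ?j) + B ?i ?j * e ?i ?j"
      by (simp add: R_def Dt_minus_def Dx_minus_def p_def q_def k_def)
    then have eq: "(p + q + B ?i ?j) * e ?i ?j = R + p * e ?i j + q * e i ?j"
      by (simp add: algebra_simps)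
    have "(p + q) * \<bar>e ?i ?j\<bar> \<le> (p + q + B ?i ?j) * \<bar>e ?i ?j\<bar>"
      using B[OF ij] by (intro mult_right_mono) auto
    also have "\<dots> = \<bar>R + p * e ?i j + q * e i ?j\<bar>"
      unfolding eq[symmetric] abs_mult using p q B[OF ij] by simp
    also have "\<dots> \<le> \<bar>R\<bar> + p * \<bar>e ?i j\<bar> + q * \<bar>e i ?j\<bar>"
    proof -
      have "\<bar>p * e ?i j\<bar> = p * \<bar>e ?i j\<bar>" "\<bar>q * e i ?j\<bar> = q * \<bar>e i ?j\<bar>"
        using p q by (simp_all add: abs_mult)
      then show ?thesis by linarith
    qed
    also have "\<dots> \<le> \<tau> + p * (\<tau> * t j) + q * (\<tau> * t ?j)"
      using R p q level[of ?i] Suc by (intro add_mono mult_left_mono) auto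
    also have "\<dots> = (p + q) * (\<tau> * t ?j)"
    proof -
      have "p * (t ?j - t j) = 1" using p(2) by (simp add: k_def)
      then have "\<tau> * (p * t ?j) = \<tau> * (1 + p * t j)" by (simp add: algebra_simps)
      then show ?thesis by (simp add: algebra_simps)
    qed
    finally show ?case using p q by (simp add: mult_le_cancel_left)
  qed
qed

lemma affine_between:
  fixes c d z :: real
  assumes "z \<in> {z\<^sub>0..z\<^sub>1}" "\<bar>c + d * z\<^sub>0\<bar> \<le> E" "\<bar>c + d * z\<^sub>1\<bar> \<le> E"
  shows "\<bar>c + d * z\<bar> \<le> E"
proof (cases "0 \<le> d")
  case True
  then have "d * z\<^sub>0 \<le> d * z" "d * z \<le> d * z\<^sub>1" using assms(1) by (auto intro: mult_left_mono)
  then show ?thesis using assms(2,3) by linarith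
next
  case False
  then have "d * z \<le> d * z\<^sub>0" "d * z\<^sub>1 \<le> d * z" using assms(1) by (auto intro: mult_left_mono_neg)
  then show ?thesis using assms(2,3) by linarith
qed

text \<open>A bilinear function is affine in each variable separately, so the bound passes from the corners
first to the two vertical sides and then to the interior.\<close>

lemma bilinear_max_at_corners:
  assumes g: "bilinear_fun_on ({x\<^sub>0..x\<^sub>1} \<times> {t\<^sub>0..t\<^sub>1}) g"
    and corners: "\<And>y s. y \<in> {x\<^sub>0, x\<^sub>1} \<Longrightarrow> s \<in> {t\<^sub>0, t\<^sub>1} \<Longrightarrow> \<bar>g (y, s) - v\<bar> \<le> E"
    and x: "x \<in> {x\<^sub>0..x\<^sub>1}" and t: "t \<in> {t\<^sub>0..t\<^sub>1}"
  shows "\<bar>g (x, t) - v\<bar> \<le> E"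
proof -
  obtain c0 c1 c2 c3 where c: "\<And>x t. x \<in> {x\<^sub>0..x\<^sub>1} \<Longrightarrow> t \<in> {t\<^sub>0..t\<^sub>1} \<Longrightarrow>
      g (x, t) = c0 + c1 * x + c2 * t + c3 * x * t"
    using g unfolding bilinear_fun_on_def by fast
  have le: "x\<^sub>0 \<le> x\<^sub>1" "t\<^sub>0 \<le> t\<^sub>1" using x t by auto
  have "\<bar>(c0 + c1 * y - v) + (c2 + c3 * y) * t\<bar> \<le> E" if "y \<in> {x\<^sub>0, x\<^sub>1}" for y
  proof (rule affine_between[OF t])
    show "\<bar>(c0 + c1 * y - v) + (c2 + c3 * y) * t\<^sub>0\<bar> \<le> E" "\<bar>(c0 + c1 * y - v) + (c2 + c3 * y) * t\<^sub>1\<bar> \<le> E"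
      using corners[OF that, of t\<^sub>0] corners[OF that, of t\<^sub>1] that le c[of y t\<^sub>0] c[of y t\<^sub>1]
      by (auto simp: algebra_simps)
  qed
  from this[of x\<^sub>0] this[of x\<^sub>1] have "\<bar>(c0 + c2 * t - v) + (c1 + c3 * t) * x\<bar> \<le> E"
    by (intro affine_between[OF x]) (simp_all add: algebra_simps)
  then show ?thesis using c[OF x t] by (simp add: algebra_simps)
qed

lemma bilinear_interpolant_continuous:
  assumes x: "mesh L C N x" and t: "mesh T C M t" and V: "bilinear_interpolant N M x t Y V"
  shows "continuous_on ({0..L} \<times> {0..T}) V"
proof -
  define cell where "cell = (\<lambda>(i, j). {x (i - 1)..x i} \<times> {t (j - 1)..t j})"
  have "continuous_on (\<Union>(cell ` ({1..N} \<times> {1..M}))) V"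
  proof (rule continuous_on_closed_Union)
    fix ij assume ij: "ij \<in> {1..N} \<times> {1..M}"
    show "closed (cell ij)" by (auto simp: cell_def closed_Times split: prod.split)
    obtain i j where [simp]: "ij = (i, j)" by force
    have "bilinear_fun_on (cell ij) V"
      using V ij unfolding bilinear_interpolant_def by (simp add: cell_def)
    then obtain c0 c1 c2 c3 where "\<forall>(x, t) \<in> cell ij. V (x, t) = c0 + c1 * x + c2 * t + c3 * x * t"
      unfolding bilinear_fun_on_def by blast
    then have "\<And>p. p \<in> cell ij \<Longrightarrow> V p = c0 + c1 * fst p + c2 * snd p + c3 * fst p * snd p"
      by auto
    moreover have "continuous_on (cell ij) (\<lambda>p. c0 + c1 * fst p + c2 * snd p + c3 * fst p * snd p)"
      by (intro continuous_intros)
    ultimately show "continuous_on (cell ij) V"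
      by (metis (no_types, lifting) continuous_on_cong)
  qed auto
  moreover have "{0..L} \<times> {0..T} \<subseteq> \<Union>(cell ` ({1..N} \<times> {1..M}))"
    using mesh_cover[OF x] mesh_cover[OF t] by (fastforce simp: cell_def)
  ultimately show ?thesis by (rule continuous_on_subset)
qed

section \<open>The error estimate\<close>

context bounded_advection
begin

lemma difference_quotient_errors:
  assumes \<Lambda>: "\<And>x y t s. x \<in> {0..L} \<Longrightarrow> y \<in> {0..L} \<Longrightarrow> t \<in> {0..T} \<Longrightarrow> s \<in> {0..T} \<Longrightarrow>
      \<bar>u\<^sub>x (x, t) - u\<^sub>x (y, s)\<bar> \<le> \<Lambda> * (\<bar>x - y\<bar> + \<bar>t - s\<bar>) \<and>
      \<bar>u\<^sub>t (x, t) - u\<^sub>t (y, s)\<bar> \<le> \<Lambda> * (\<bar>x - y\<bar> + \<bar>t - s\<bar>)" and "0 \<le> \<Lambda>"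
    and "0 \<le> y" "y < x" "x \<le> L" "0 \<le> s" "s < t" "t \<le> T"
  shows "\<bar>(u (x, t) - u (y, t)) / (x - y) - u\<^sub>x (x, t)\<bar> \<le> \<Lambda> * (x - y)"
    and "\<bar>(u (x, t) - u (x, s)) / (t - s) - u\<^sub>t (x, t)\<bar> \<le> \<Lambda> * (t - s)"
proof -
  obtain \<xi> where \<xi>: "\<xi> \<in> {y<..<x}" "u (x, t) - u (y, t) = (x - y) * u\<^sub>x (\<xi>, t)"
    using u_mean_value_x[of y x t] assms by auto
  have "\<bar>u\<^sub>x (\<xi>, t) - u\<^sub>x (x, t)\<bar> \<le> \<Lambda> * (\<bar>\<xi> - x\<bar> + \<bar>t - t\<bar>)"
    using \<Lambda>[of \<xi> x t t] \<xi> assms by auto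
  also have "\<dots> \<le> \<Lambda> * (x - y)"
    using \<xi> \<open>0 \<le> \<Lambda>\<close> by (intro mult_left_mono) auto
  finally show "\<bar>(u (x, t) - u (y, t)) / (x - y) - u\<^sub>x (x, t)\<bar> \<le> \<Lambda> * (x - y)"
    using \<xi> by simp
  obtain \<tau> where \<tau>: "\<tau> \<in> {s<..<t}" "u (x, t) - u (x, s) = (t - s) * u\<^sub>t (x, \<tau>)"
    using u_mean_value_t[of s t x] assms by auto
  have "\<bar>u\<^sub>t (x, \<tau>) - u\<^sub>t (x, t)\<bar> \<le> \<Lambda> * (\<bar>x - x\<bar> + \<bar>\<tau> - t\<bar>)"
    using \<Lambda>[of x x \<tau> t] \<tau> assms by auto
  also have "\<dots> \<le> \<Lambda> * (t - s)"
    using \<tau> \<open>0 \<le> \<Lambda>\<close> by (intro mult_left_mono) auto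
  finally show "\<bar>(u (x, t) - u (x, s)) / (t - s) - u\<^sub>t (x, t)\<bar> \<le> \<Lambda> * (t - s)"
    using \<tau> by simp
qed

theorem upwind_interpolant_error:
  assumes b_nonneg: "\<And>p. p \<in> {0..L} \<times> {0..T} \<Longrightarrow> 0 \<le> b p"
  shows "\<exists>C. \<forall>N M x t U V. mesh L Cs N x \<longrightarrow> mesh T Cs M t \<longrightarrow> solves_upwind N M x t a b f u U \<longrightarrow>
    bilinear_interpolant N M x t U V \<longrightarrow>
    (\<forall>p\<in>{0..L} \<times> {0..T}. \<bar>V p - u p\<bar> \<le> C * (1 / real N + 1 / real M))"
proof -
  obtain \<Lambda> where \<Lambda>: "0 \<le> \<Lambda>" "\<And>x y t s. x \<in> {0..L} \<Longrightarrow> y \<in> {0..L} \<Longrightarrow> t \<in> {0..T} \<Longrightarrow> s \<in> {0..T} \<Longrightarrow>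
      \<bar>u\<^sub>x (x, t) - u\<^sub>x (y, s)\<bar> \<le> \<Lambda> * (\<bar>x - y\<bar> + \<bar>t - s\<bar>) \<and>
      \<bar>u\<^sub>t (x, t) - u\<^sub>t (y, s)\<bar> \<le> \<Lambda> * (\<bar>x - y\<bar> + \<bar>t - s\<bar>)"
    using gradient_Lipschitz by blast
  have "\<bar>V (y, s) - u (y, s)\<bar> \<le> ((1 + K) * \<Lambda> * T + K) * Cs * (1 / real N + 1 / real M)"
    if x: "mesh L Cs N x" and t: "mesh T Cs M t" and U: "solves_upwind N M x t a b f u U"
      and V: "bilinear_interpolant N M x t U V" and y: "y \<in> {0..L}" and s: "s \<in> {0..T}"
    for N M x t U V y s
  proof -
    let ?H = "Cs / real N" and ?K = "Cs / real M"
    define e where "e = (\<lambda>i j. U i j - u (x i, t j))"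
    define \<tau> where "\<tau> = (1 + K) * \<Lambda> * (?H + ?K)"
    have "1 \<in> {1..N}" "1 \<in> {1..M}" using x t by (auto simp: mesh_def)
    then have HK: "0 \<le> ?H" "0 \<le> ?K"
      using mesh_step(1,2)[OF x, of 1] mesh_step(1,2)[OF t, of 1] by linarith+
    have \<tau>: "0 \<le> \<tau>" using HK K_nonneg \<Lambda>(1) by (simp add: \<tau>_def)
    have residual: "\<bar>Dt_minus t e i j + a (x i, t j) * Dx_minus x e i j + b (x i, t j) * e i j\<bar> \<le> \<tau>"
      if i: "i \<in> {1..N}" and j: "j \<in> {1..M}" for i j
    proof -
      note xi = mesh_step[OF x i] and tj = mesh_step[OF t j]
      have in_box: "(x i, t j) \<in> {0..L} \<times> {0..T}" using xi tj by auto
      have e_ij: "e i j = U i j - u (x i, t j)" by (simp add: e_def)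
      define p where "p = (u (x i, t j) - u (x (i - 1), t j)) / (x i - x (i - 1)) - u\<^sub>x (x i, t j)"
      define q where "q = (u (x i, t j) - u (x i, t (j - 1))) / (t j - t (j - 1)) - u\<^sub>t (x i, t j)"
      have p: "\<bar>p\<bar> \<le> \<Lambda> * ?H"
        using difference_quotient_errors(1)[OF \<Lambda>(2,1), of "x (i - 1)" "x i" "t (j - 1)" "t j"]
          mult_left_mono[OF xi(2) \<Lambda>(1)] xi tj by (simp add: p_def)
      have q: "\<bar>q\<bar> \<le> \<Lambda> * ?K"
        using difference_quotient_errors(2)[OF \<Lambda>(2,1), of "x (i - 1)" "x i" "t (j - 1)" "t j"]
          mult_left_mono[OF tj(2) \<Lambda>(1)] xi tj by (simp add: q_def)
      have scheme: "Dt_minus t U i j + a (x i, t j) * Dx_minus x U i j + b (x i, t j) * U i j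
          = u\<^sub>t (x i, t j) + a (x i, t j) * u\<^sub>x (x i, t j) + b (x i, t j) * u (x i, t j)"
        using U i j pde[OF in_box] by (simp add: solves_upwind_def)
      have differences: "Dt_minus t e i j = Dt_minus t U i j - (q + u\<^sub>t (x i, t j))"
        "Dx_minus x e i j = Dx_minus x U i j - (p + u\<^sub>x (x i, t j))"
        by (simp_all add: e_def Dt_minus_def Dx_minus_def p_def q_def flip: diff_divide_distrib)
      have "Dt_minus t e i j + a (x i, t j) * Dx_minus x e i j + b (x i, t j) * e i j
          = - (q + a (x i, t j) * p)"
        unfolding differences e_ij using scheme by (simp add: algebra_simps)
      moreover have "\<bar>a (x i, t j) * p\<bar> \<le> K * (\<Lambda> * ?H)"
        unfolding abs_mult using in_box p K_nonneg by (intro mult_mono bound) auto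
      then have "\<bar>q + a (x i, t j) * p\<bar> \<le> \<Lambda> * ?K + K * (\<Lambda> * ?H)"
        using q by linarith
      moreover have "\<Lambda> * ?K + K * (\<Lambda> * ?H) \<le> \<tau>"
      proof -
        \<comment> \<open>The cross terms are only there to give \<open>\<tau>\<close> a product form.\<close>
        have "\<tau> = \<Lambda> * ?K + K * (\<Lambda> * ?H) + (\<Lambda> * ?H + K * (\<Lambda> * ?K))"
          by (simp add: \<tau>_def algebra_simps)
        moreover have "0 \<le> \<Lambda> * ?H" "0 \<le> K * (\<Lambda> * ?K)"
          using \<Lambda>(1) HK K_nonneg by (intro mult_nonneg_nonneg; simp)+
        ultimately show ?thesis by linarith
      qed
      ultimately show ?thesis by simp
    qed
    have nodes: "\<bar>e i j\<bar> \<le> \<tau> * T" if "i \<le> N" "j \<le> M" for i j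
    proof -
      have "\<bar>e i j\<bar> \<le> \<tau> * t j"
      proof (rule upwind_stability[OF x t _ _ residual])
        show "0 \<le> a (x i, t j)" if "i \<in> {1..N}" "j \<in> {1..M}" for i j
          using a_ge[of "(x i, t j)"] mesh_step[OF x that(1)] mesh_step[OF t that(2)] pos by auto
        show "0 \<le> b (x i, t j)" if "i \<in> {1..N}" "j \<in> {1..M}" for i j
          using b_nonneg[of "(x i, t j)"] mesh_step[OF x that(1)] mesh_step[OF t that(2)] by auto
        show "e 0 j = 0" if "j \<in> {1..M}" for j
          using U x that by (simp add: e_def solves_upwind_def mesh_def)
        show "e i 0 = 0" if "i \<le> N" for i
          using U t that by (simp add: e_def solves_upwind_def mesh_def)
      qed (use \<tau> that in auto)
      also have "\<dots> \<le> \<tau> * T" using mesh_in[OF t that(2)] \<tau> by (intro mult_left_mono) auto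
      finally show ?thesis .
    qed
    obtain i where i: "i \<in> {1..N}" "y \<in> {x (i - 1)..x i}" using mesh_cover[OF x y] by auto
    obtain j where j: "j \<in> {1..M}" "s \<in> {t (j - 1)..t j}" using mesh_cover[OF t s] by auto
    have "\<bar>V (y, s) - u (y, s)\<bar> \<le> \<tau> * T + K * (?H + ?K)"
    proof (rule bilinear_max_at_corners[OF _ _ i(2) j(2)])
      show "bilinear_fun_on ({x (i - 1)..x i} \<times> {t (j - 1)..t j}) V"
        using V i j unfolding bilinear_interpolant_def by blast
      fix y' s' assume "y' \<in> {x (i - 1), x i}" "s' \<in> {t (j - 1), t j}"
      then obtain i' j' where corner: "i' \<in> {i - 1, i}" "y' = x i'" "j' \<in> {j - 1, j}" "s' = t j'" by blast
      then have le: "i' \<le> N" "j' \<le> M" using i j by auto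
      have "\<bar>V (x i', t j') - u (x i', t j')\<bar> \<le> \<tau> * T"
        using nodes[OF le] V le by (simp add: e_def bilinear_interpolant_def)
      moreover have "\<bar>u (x i', t j') - u (y, s)\<bar> \<le> K * (\<bar>x i' - y\<bar> + \<bar>t j' - s\<bar>)"
        using mesh_in[OF x le(1)] mesh_in[OF t le(2)] y s by (intro Lipschitz) auto
      moreover have "\<bar>x i' - y\<bar> \<le> ?H" "\<bar>t j' - s\<bar> \<le> ?K"
        using corner i(2) j(2) mesh_step(2)[OF x i(1)] mesh_step(2)[OF t j(1)] by auto
      then have "K * (\<bar>x i' - y\<bar> + \<bar>t j' - s\<bar>) \<le> K * (?H + ?K)"
        using K_nonneg by (intro mult_left_mono) auto
      ultimately show "\<bar>V (y', s') - u (y, s)\<bar> \<le> \<tau> * T + K * (?H + ?K)"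
        unfolding corner by linarith
    qed
    also have "\<dots> = ((1 + K) * \<Lambda> * T + K) * Cs * (1 / real N + 1 / real M)"
      by (simp add: \<tau>_def algebra_simps add_divide_distrib)
    finally show ?thesis .
  qed
  then show ?thesis by (intro exI[of _ "((1 + K) * \<Lambda> * T + K) * Cs"]) auto
qed

end

lemma real_derivative_unique_on_interval:
  assumes "c < d" "z \<in> {c..d}"
    and "(g has_real_derivative D) (at z within {c..d})" "(g has_real_derivative D') (at z within {c..d})"
  shows "D = D'"
  using assms vector_derivative_unique_within_closed_interval[of c d z g D D']
  by (simp add: has_real_derivative_iff_has_vector_derivative)

text \<open>Stating that all sufficiently large constants are admissible lets the constants of
several functions be merged into one by conjunction of eventual properties.\<close>

lemma eventually_C1_constant:
  fixes g :: "real \<times> real \<Rightarrow> real"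
  assumes "Ck_on 1 ({0..L} \<times> {0..T}) g"
  shows "\<forall>\<^sub>F K in at_top. (\<forall>p\<in>{0..L} \<times> {0..T}. \<bar>g p\<bar> \<le> K) \<and>
    (\<forall>x\<in>{0..L}. \<forall>y\<in>{0..L}. \<forall>t\<in>{0..T}. \<forall>s\<in>{0..T}.
      \<bar>g (x, t) - g (y, s)\<bar> \<le> K * (\<bar>x - y\<bar> + \<bar>t - s\<bar>))"
proof -
  have "compact ({0..L} \<times> {0..T})" "convex ({0..L} \<times> {0..T})"
    by (auto intro!: compact_Times convex_Times)
  then obtain K\<^sub>0 where K\<^sub>0: "\<And>p. p \<in> {0..L} \<times> {0..T} \<Longrightarrow> \<bar>g p\<bar> \<le> K\<^sub>0"
    "\<And>p q. p \<in> {0..L} \<times> {0..T} \<Longrightarrow> q \<in> {0..L} \<times> {0..T} \<Longrightarrow> \<bar>g p - g q\<bar> \<le> K\<^sub>0 * norm (p - q)"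
    using C1_Lipschitz[OF _ _ assms] by metis
  have "(\<forall>p\<in>{0..L} \<times> {0..T}. \<bar>g p\<bar> \<le> K) \<and>
    (\<forall>x\<in>{0..L}. \<forall>y\<in>{0..L}. \<forall>t\<in>{0..T}. \<forall>s\<in>{0..T}.
      \<bar>g (x, t) - g (y, s)\<bar> \<le> K * (\<bar>x - y\<bar> + \<bar>t - s\<bar>))" if K: "max 0 K\<^sub>0 \<le> K" for K
  proof (intro conjI ballI)
    show "\<bar>g p\<bar> \<le> K" if "p \<in> {0..L} \<times> {0..T}" for p
      using K\<^sub>0(1)[OF that] K by linarith
    fix x y t s assume *: "x \<in> {0..L}" "y \<in> {0..L}" "t \<in> {0..T}" "s \<in> {0..T}"
    have "\<bar>g (x, t) - g (y, s)\<bar> \<le> K\<^sub>0 * norm ((x, t) - (y, s))"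
      using * by (intro K\<^sub>0(2)) auto
    also have "\<dots> \<le> K * norm ((x, t) - (y, s))"
      using K by (intro mult_right_mono) auto
    also have "\<dots> \<le> K * (\<bar>x - y\<bar> + \<bar>t - s\<bar>)"
      using K norm_Pair_le[of "x - y" "t - s"] by (intro mult_left_mono) auto
    finally show "\<bar>g (x, t) - g (y, s)\<bar> \<le> K * (\<bar>x - y\<bar> + \<bar>t - s\<bar>)" .
  qed
  then show ?thesis
    by (rule eventually_mono[OF eventually_ge_at_top])
qed

lemma eventually_C2_constant:
  fixes g :: "real \<times> real \<Rightarrow> real"
  assumes "Ck_on 2 ({0..L} \<times> {0..T}) g"
  shows "\<forall>\<^sub>F K in at_top. \<forall>x y d t. 0 < d \<longrightarrow> x \<in> {0..L - d} \<longrightarrow> y \<in> {0..L - d} \<longrightarrow> t \<in> {0..T} \<longrightarrow>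
    \<bar>(g (x + d, t) - g (x, t)) - (g (y + d, t) - g (y, t))\<bar> \<le> K * d * \<bar>x - y\<bar>"
proof -
  have "compact ({0..L} \<times> {0..T})" "convex ({0..L} \<times> {0..T})"
    by (auto intro!: compact_Times convex_Times)
  then obtain K\<^sub>0 where K\<^sub>0: "\<And>p q d. p \<in> {0..L} \<times> {0..T} \<Longrightarrow> q \<in> {0..L} \<times> {0..T} \<Longrightarrow>
      p + d \<in> {0..L} \<times> {0..T} \<Longrightarrow> q + d \<in> {0..L} \<times> {0..T} \<Longrightarrow>
      \<bar>(g (p + d) - g p) - (g (q + d) - g q)\<bar> \<le> K\<^sub>0 * norm d * norm (p - q)"
    using C2_second_difference[OF _ _ assms] by metis
  have "\<bar>(g (x + d, t) - g (x, t)) - (g (y + d, t) - g (y, t))\<bar> \<le> K * d * \<bar>x - y\<bar>"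
    if "K\<^sub>0 \<le> K" "0 < d" "x \<in> {0..L - d}" "y \<in> {0..L - d}" "t \<in> {0..T}" for K x y d t
  proof -
    have "\<bar>(g (x + d, t) - g (x, t)) - (g (y + d, t) - g (y, t))\<bar> \<le> K\<^sub>0 * d * \<bar>x - y\<bar>"
      using K\<^sub>0[of "(x, t)" "(y, t)" "(d, 0)"] that by (simp add: norm_Pair)
    also have "\<dots> \<le> K * d * \<bar>x - y\<bar>" using that by (intro mult_right_mono) auto
    finally show ?thesis .
  qed
  then show ?thesis
    by (intro eventually_mono[OF eventually_ge_at_top[of K\<^sub>0]]) blast
qed

text \<open>The equation extends from \<open>(0, L] \<times> (0, T]\<close> to the closed rectangle by continuity of the
partial derivatives. The bound on the initial line comes from \<open>\<phi>\<close>, the one on the inflow boundary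
from \<open>\<psi>\<close>, whose derivative is \<open>u\<^sub>t (0, t)\<close>.\<close>

lemma regular_problem_is_bounded_advection:
  assumes "0 < L" and "0 < T" and "0 < \<alpha>"
    and a: "Ck_on 2 ({0..L} \<times> {0..T}) a" and b: "Ck_on 2 ({0..L} \<times> {0..T}) b"
    and f: "Ck_on 2 ({0..L} \<times> {0..T}) f" and \<phi>: "Ck_on 2 {0..L} \<phi>" and \<psi>: "Ck_on 2 {0..T} \<psi>"
    and a_ge: "\<And>p. p \<in> {0..L} \<times> {0..T} \<Longrightarrow> a p \<ge> \<alpha>"
    and u: "Ck_on 1 ({0..L} \<times> {0..T}) u" and sol: "solves_ibvp L T a b f \<phi> \<psi> u"
  shows "\<exists>K u\<^sub>x u\<^sub>t. bounded_advection L T \<alpha> K a b f u u\<^sub>x u\<^sub>t"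
proof -
  let ?B = "{0..L} \<times> {0..T}"
  obtain u' where u': "\<And>p. p \<in> ?B \<Longrightarrow> (u has_derivative u' p) (at p within ?B)"
      and u'_cont: "\<And>v. v \<in> Basis \<Longrightarrow> continuous_on ?B (\<lambda>p. u' p v)"
    using u by auto
  define u\<^sub>x where "u\<^sub>x = (\<lambda>p. u' p (1, 0))"
  define u\<^sub>t where "u\<^sub>t = (\<lambda>p. u' p (0, 1))"
  have cont: "continuous_on ?B u\<^sub>x" "continuous_on ?B u\<^sub>t"
    unfolding u\<^sub>x_def u\<^sub>t_def by (intro u'_cont; simp add: Basis_prod_def)+
  have u'_eq: "u' p v = fst v * u\<^sub>x p + snd v * u\<^sub>t p" if "p \<in> ?B" for p v
  proof -
    interpret D: bounded_linear "u' p" using u'[OF that] by (rule has_derivative_bounded_linear)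
    have "u' p v = u' p (fst v *\<^sub>R (1, 0) + snd v *\<^sub>R (0, 1))" by (cases v) simp
    then show ?thesis unfolding D.add D.scaleR by (simp add: u\<^sub>x_def u\<^sub>t_def)
  qed
  have derivative: "(u has_derivative (\<lambda>v. fst v * u\<^sub>x p + snd v * u\<^sub>t p)) (at p within ?B)" if "p \<in> ?B" for p
    using u'[OF that] by (rule has_derivative_eq_rhs) (simp add: u'_eq[OF that] fun_eq_iff)
  have partial: "((\<lambda>y. u (y, t)) has_real_derivative u\<^sub>x (x, t)) (at x within {0..L})"
      "((\<lambda>s. u (x, s)) has_real_derivative u\<^sub>t (x, t)) (at t within {0..T})"
    if "x \<in> {0..L}" "t \<in> {0..T}" for x t
    using has_partial_derivatives[OF u'[of "(x, t)"]] that by (auto simp: u\<^sub>x_def u\<^sub>t_def)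
  have cont_on: "continuous_on ?B g" if "Ck_on k ?B g" for g k
    using that by (rule Ck_on_imp_continuous_on)
  have pde: "u\<^sub>t p + a p * u\<^sub>x p + b p * u p = f p" if "p \<in> ?B" for p
  proof -
    let ?F = "\<lambda>p. u\<^sub>t p + a p * u\<^sub>x p + b p * u p - f p"
    have closure: "closure ({0<..L} \<times> {0<..T}) = ?B"
      using assms(1,2) by (simp add: closure_Times)
    have "?F p = 0"
    proof (rule continuous_constant_on_closure[where f = ?F])
      show "continuous_on (closure ({0<..L} \<times> {0<..T})) ?F"
        unfolding closure by (intro continuous_intros cont cont_on[OF a] cont_on[OF b] cont_on[OF f] cont_on[OF u])
      show "p \<in> closure ({0<..L} \<times> {0<..T})" unfolding closure by (fact that)
      fix q assume "q \<in> {0<..L} \<times> {0<..T}"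
      then obtain x t where q: "q = (x, t)" "x \<in> {0<..L}" "t \<in> {0<..T}" by auto
      then obtain ux ut where *: "((\<lambda>y. u (y, t)) has_real_derivative ux) (at x within {0..L})"
          "((\<lambda>s. u (x, s)) has_real_derivative ut) (at t within {0..T})"
          "ut + a (x, t) * ux + b (x, t) * u (x, t) = f (x, t)"
        using sol unfolding solves_ibvp_def by blast
      have "x \<in> {0..L}" "t \<in> {0..T}" using q by auto
      then have "ux = u\<^sub>x (x, t)" "ut = u\<^sub>t (x, t)"
        using real_derivative_unique_on_interval[OF assms(1) _ *(1) partial(1)]
          real_derivative_unique_on_interval[OF assms(2) _ *(2) partial(2)] by blast+
      then show "?F q = 0" using *(3) q by simp
    qed
    then show ?thesis by simp
  qed
  obtain Kx where Kx: "\<And>p. p \<in> ?B \<Longrightarrow> \<bar>u\<^sub>x p\<bar> \<le> Kx"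
    using compact_imp_bounded[OF compact_continuous_image[OF cont(1)]] unfolding bounded_iff
    by (fastforce simp: compact_Times)
  obtain K\<phi> where K\<phi>: "\<And>x y d. x \<in> {0..L} \<Longrightarrow> y \<in> {0..L} \<Longrightarrow> x + d \<in> {0..L} \<Longrightarrow> y + d \<in> {0..L} \<Longrightarrow>
      \<bar>(\<phi> (x + d) - \<phi> x) - (\<phi> (y + d) - \<phi> y)\<bar> \<le> K\<phi> * \<bar>d\<bar> * \<bar>x - y\<bar>"
    using C2_second_difference[OF compact_Icc convex_real_interval(5) \<phi>] unfolding real_norm_def by blast
  obtain \<psi>' where \<psi>': "\<And>t. t \<in> {0..T} \<Longrightarrow> (\<psi> has_derivative \<psi>' t) (at t within {0..T})"
      "Ck_on 1 {0..T} (\<lambda>t. \<psi>' t 1)"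
    using \<psi> unfolding numeral_2_eq_2 Ck_on.simps(2)[of "Suc 0"] One_nat_def Basis_real_def by blast
  obtain K\<psi> where K\<psi>: "\<And>t s. t \<in> {0..T} \<Longrightarrow> s \<in> {0..T} \<Longrightarrow> \<bar>\<psi>' t 1 - \<psi>' s 1\<bar> \<le> K\<psi> * \<bar>t - s\<bar>"
    using C1_Lipschitz[OF compact_Icc convex_real_interval(5) \<psi>'(2)] unfolding real_norm_def by blast
  have u\<^sub>t_inflow: "u\<^sub>t (0, t) = \<psi>' t 1" if "t \<in> {0..T}" for t
  proof (rule real_derivative_unique_on_interval[OF assms(2) that])
    show "((\<lambda>s. u (0, s)) has_real_derivative u\<^sub>t (0, t)) (at t within {0..T})"
      using partial(2)[of 0 t] that assms(1) by auto
    interpret D: bounded_linear "\<psi>' t" using \<psi>'(1)[OF that] by (rule has_derivative_bounded_linear)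
    have "\<psi>' t = (*) (\<psi>' t 1)"
    proof
      show "\<psi>' t h = \<psi>' t 1 * h" for h using D.scaleR[of h 1] by simp
    qed
    then have "(\<psi> has_real_derivative \<psi>' t 1) (at t within {0..T})"
      using \<psi>'(1)[OF that] by (simp only: has_field_derivative_def)
    then show "((\<lambda>s. u (0, s)) has_real_derivative \<psi>' t 1) (at t within {0..T})"
      by (rule has_field_derivative_transform_within[OF _ zero_less_one that])
         (use sol in \<open>auto simp: solves_ibvp_def\<close>)
  qed
  have C1: "Ck_on 1 ?B g" if "Ck_on 2 ?B g" for g
    using that Ck_on_Suc_imp unfolding numeral_2_eq_2 One_nat_def by blast
  have "\<forall>\<^sub>F K in at_top. bounded_advection L T \<alpha> K a b f u u\<^sub>x u\<^sub>t"
    using eventually_C1_constant[OF C1[OF a]] eventually_C1_constant[OF C1[OF b]]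
      eventually_C1_constant[OF C1[OF f]] eventually_C1_constant[OF u]
      eventually_C2_constant[OF a] eventually_C2_constant[OF b] eventually_C2_constant[OF f]
      eventually_ge_at_top[of Kx] eventually_ge_at_top[of K\<phi>] eventually_ge_at_top[of K\<psi>]
  proof eventually_elim
    case (elim K)
    show ?case
    proof
      show "\<bar>g p\<bar> \<le> K" if "g \<in> {a, b, f, u, u\<^sub>x}" "p \<in> ?B" for g p
      proof (cases "g = u\<^sub>x")
        case True
        then show ?thesis using Kx[OF that(2)] elim(8) by simp
      next
        case False
        then have "g \<in> {a, b, f, u}" using that(1) by blast
        then show ?thesis using elim(1-4) that(2) by blast
      qed
      show "\<bar>g (x, t) - g (y, s)\<bar> \<le> K * (\<bar>x - y\<bar> + \<bar>t - s\<bar>)"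
        if "g \<in> {a, b, f, u}" "x \<in> {0..L}" "y \<in> {0..L}" "t \<in> {0..T}" "s \<in> {0..T}" for g x y t s
        using elim(1-4) that by blast
      show "\<bar>(g (x + d, t) - g (x, t)) - (g (y + d, t) - g (y, t))\<bar> \<le> K * d * \<bar>x - y\<bar>"
        if g: "g \<in> {a, b, f} \<or> g = u \<and> t = 0" and d: "0 < d"
          and xyt: "x \<in> {0..L - d}" "y \<in> {0..L - d}" "t \<in> {0..T}" for g x y d t
        using g
      proof
        assume "g \<in> {a, b, f}"
        then show ?thesis using elim(5-7) d xyt by blast
      next
        assume "g = u \<and> t = 0"
        then have "\<bar>(g (x + d, t) - g (x, t)) - (g (y + d, t) - g (y, t))\<bar>
            = \<bar>(\<phi> (x + d) - \<phi> x) - (\<phi> (y + d) - \<phi> y)\<bar>"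
          using sol d xyt by (simp add: solves_ibvp_def)
        also have "\<dots> \<le> K\<phi> * d * \<bar>x - y\<bar>"
          using K\<phi>[of x y d] d xyt by simp
        also have "\<dots> \<le> K * d * \<bar>x - y\<bar>"
          using elim(9) d by (intro mult_right_mono) auto
        finally show ?thesis .
      qed
      show "\<bar>u\<^sub>t (0, t) - u\<^sub>t (0, s)\<bar> \<le> K * \<bar>t - s\<bar>" if "t \<in> {0..T}" "s \<in> {0..T}" for t s
      proof -
        have "\<bar>u\<^sub>t (0, t) - u\<^sub>t (0, s)\<bar> \<le> K\<psi> * \<bar>t - s\<bar>"
          using K\<psi>[OF that] that by (simp add: u\<^sub>t_inflow)
        also have "\<dots> \<le> K * \<bar>t - s\<bar>" using elim(10) by (intro mult_right_mono) auto
        finally show ?thesis .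
      qed
    qed (use assms(1-3) a_ge pde derivative cont in auto)
  qed
  then show ?thesis by (auto simp: eventually_at_top_linorder)
qed

lemma Linf_norm_le:
  assumes "continuous_on S g" "S \<in> sets lebesgue" "\<And>p. p \<in> S \<Longrightarrow> \<bar>g p\<bar> \<le> C"
  shows "Linf_norm S g \<le> ereal C"
  unfolding Linf_norm_def
proof (rule esssup_I)
  show "(\<lambda>p. ereal \<bar>g p\<bar>) \<in> borel_measurable (lebesgue_on S)"
    using continuous_imp_measurable_on_sets_lebesgue[OF assms(1,2)] by simp
  show "AE p in lebesgue_on S. ereal \<bar>g p\<bar> \<le> ereal C"
    using assms(3) by (intro AE_I2) simp
qed

theorem theorem1:
  fixes L T \<alpha> Cs :: real
    and a b f u :: "real \<times> real \<Rightarrow> real"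
    and \<phi> \<psi> :: "real \<Rightarrow> real"
  assumes "0 < L" and "0 < T" and "0 < \<alpha>"
    and "Ck_on 2 ({0..L} \<times> {0..T}) a"
    and "Ck_on 2 ({0..L} \<times> {0..T}) b"
    and "Ck_on 2 ({0..L} \<times> {0..T}) f"
    and "Ck_on 2 {0..L} \<phi>"
    and "Ck_on 2 {0..T} \<psi>"
    and "\<And>p. p \<in> {0..L} \<times> {0..T} \<Longrightarrow> a p \<ge> \<alpha>"
    and "\<And>p. p \<in> {0..L} \<times> {0..T} \<Longrightarrow> b p \<ge> 0"
    and "Ck_on 1 ({0..L} \<times> {0..T}) u"
    and "solves_ibvp L T a b f \<phi> \<psi> u"
  shows "\<exists>C::real. \<forall>(N::nat) (M::nat) (x::nat \<Rightarrow> real) (t::nat \<Rightarrow> real)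
           (U::nat \<Rightarrow> nat \<Rightarrow> real) (Ubar::real \<times> real \<Rightarrow> real).
           mesh L Cs N x \<longrightarrow> mesh T Cs M t \<longrightarrow>
           solves_upwind N M x t a b f u U \<longrightarrow>
           bilinear_interpolant N M x t U Ubar \<longrightarrow>
           Linf_norm ({0..L} \<times> {0..T}) (\<lambda>p. Ubar p - u p)
             \<le> ereal (C * (1 / real N + 1 / real M))"
proof -
  obtain K u\<^sub>x u\<^sub>t where "bounded_advection L T \<alpha> K a b f u u\<^sub>x u\<^sub>t"
    using regular_problem_is_bounded_advection[OF assms(1-9,11,12)] by blast
  then interpret bounded_advection L T \<alpha> K a b f u u\<^sub>x u\<^sub>t .
  obtain C where C: "\<And>N M x t U V p. mesh L Cs N x \<Longrightarrow> mesh T Cs M t \<Longrightarrow>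
      solves_upwind N M x t a b f u U \<Longrightarrow> bilinear_interpolant N M x t U V \<Longrightarrow>
      p \<in> {0..L} \<times> {0..T} \<Longrightarrow> \<bar>V p - u p\<bar> \<le> C * (1 / real N + 1 / real M)"
    using upwind_interpolant_error[OF assms(10), of Cs] by blast
  have "{0..L} \<times> {0..T} \<in> sets lebesgue"
    by (intro lmeasurable_compact fmeasurableD compact_Times) auto
  moreover have "continuous_on ({0..L} \<times> {0..T}) u"
    using assms(11) by (rule Ck_on_imp_continuous_on)
  ultimately show ?thesis
    by (intro exI[of _ C] allI impI Linf_norm_le)
       (auto intro!: continuous_intros bilinear_interpolant_continuous C)
qed

end
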